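(* Let $b\ge 2$ be an integer. For almost every $\alpha\in(1,2)$ (with respect to Lebesgue measure), with type III base $b$ continued logarithm terms $1, c_1b^{a_1}, c_2b^{a_2},\dots$, the limit $P_\alpha(k,\ell)$ exists and $$P_\alpha(k,\ell)=\frac{\log\frac{(1+\ell^{-1}b^{-k})(b+(\ell+1)^{-1}b^{-k})}{(b+\ell^{-1}b^{-k})(1+(\ell+1)^{-1}b^{-k})}}{\log\frac{2b}{b+1}}$$ for all $k\in\mathbb{Z}_{\ge 0}$ and $\ell\in\{1,2,\dots,b-1\}$.
   Context: Fix an integer base $b\ge 2$. For real $\alpha\ge 1$, the type III base $b$ continued logarithm for $\alpha$ is defined by the recursion $y_0=\alpha$, and for $n\ge 0$: $a_n=\lfloor \log_b y_n\rfloor$, $c_n=\lfloor y_n/b^{a_n}\rfloor$; if $y_n=c_nb^{a_n}$ the process terminates; otherwise $y_{n+1}=\dfrac{b^{a_n}}{y_n-c_nb^{a_n}}$. (Thus $a_n\in\mathbb{Z}_{\ge 0}$, $c_n\in\{1,\dots,b-1\}$; the process is infinite for irrational $\alpha$.) For $\alpha$ with infinite expansion, $k\in\mathbb{Z}_{\ge 0}$ and $\ell\in\{1,\dots,b-1\}$, define $$P_\alpha(k,\ell)=\lim_{N\to\infty}\frac{|\{n\in\mathbb{N}: n\le N,\ a_n=k,\ c_n=\ell\}|}{N}$$ if this limit exists, where $\mathbb{N}=\{1,2,3,\dots\}$. *)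

theory Defs
  imports "HOL-Analysis.Analysis"
begin

definition clog_exponent :: "nat \<Rightarrow> real \<Rightarrow> int" where
  "clog_exponent b y = \<lfloor>log (real b) y\<rfloor>"

definition clog_coeff :: "nat \<Rightarrow> real \<Rightarrow> int" where
  "clog_coeff b y = \<lfloor>y / real b powi clog_exponent b y\<rfloor>"

text \<open>The sequence of the \<open>y\<^sub>n\<close>, started at \<open>y\<^sub>0 = \<alpha>\<close>.
  The value \<^const>\<open>None\<close> at \<open>n\<close> means that the process stopped before step \<open>n\<close>,
  so that \<open>y\<^sub>n\<close> is undefined.\<close>

primrec clog_y :: "nat \<Rightarrow> real \<Rightarrow> nat \<Rightarrow> real option" where
  "clog_y b \<alpha> 0 = Some \<alpha>"
| "clog_y b \<alpha> (Suc n) =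
     (case clog_y b \<alpha> n of
        None \<Rightarrow> None
      | Some y \<Rightarrow>
          (let p = real b powi clog_exponent b y;
               c = real_of_int (clog_coeff b y)
           in if y = c * p then None else Some (p / (y - c * p))))"

text \<open>The pair \<open>(a\<^sub>n, c\<^sub>n)\<close>, if it is defined.\<close>

definition clog_digit :: "nat \<Rightarrow> real \<Rightarrow> nat \<Rightarrow> (int \<times> int) option" where
  "clog_digit b \<alpha> n =
     map_option (\<lambda>y. (clog_exponent b y, clog_coeff b y)) (clog_y b \<alpha> n)"

definition clog_infinite :: "nat \<Rightarrow> real \<Rightarrow> bool" where
  "clog_infinite b \<alpha> \<longleftrightarrow> (\<forall>n. clog_y b \<alpha> n \<noteq> None)"

text \<open>Position \<open>0\<close> is not counted. The value at \<open>N = 0\<close> is the junk value \<open>0\<close>.\<close>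

definition clog_freq :: "nat \<Rightarrow> real \<Rightarrow> nat \<Rightarrow> nat \<Rightarrow> nat \<Rightarrow> real" where
  "clog_freq b \<alpha> k l N =
     real (card {n. 1 \<le> n \<and> n \<le> N \<and> clog_digit b \<alpha> n = Some (int k, int l)}) / real N"

text \<open>Meaningful only if \<open>clog_infinite b \<alpha>\<close> and \<open>convergent (clog_freq b \<alpha> k l)\<close>.\<close>

definition clog_P :: "nat \<Rightarrow> real \<Rightarrow> nat \<Rightarrow> nat \<Rightarrow> real" where
  "clog_P b \<alpha> k l = lim (clog_freq b \<alpha> k l)"

end

theory Submission
  imports Defs "HOL-Probability.Probability" "HOL-Real_Asymp.Real_Asymp" "HOL-Library.Discrete_Functions"
begin

text \<open>
  In the variable \<open>x = 1 / y\<close> the process iterates a map of Gauss type whose full branches have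
  the inverses \<open>t \<mapsto> 1 / (b\<^sup>a (c + t))\<close> and whose invariant density is proportional to
  \<open>1 / ((1 + x) (b + x))\<close>; the claimed frequency is the invariant mass of a cell of the partition
  into branches. In the distance \<open>\<bar>ln (1 + x) - ln (1 + y)\<bar>\<close> every inverse branch contracts by
  \<open>1 / 2\<close> and the weights of the normalised transfer operator have distortion at most \<open>4\<close>. Hence the
  operator maps the cone of functions of distortion \<open>16\<close> into the cone of distortion
  \<open>4 + 16 / 2 = 12\<close>, which leaves room to subtract a fixed fraction of the mean, so its iterates
  converge exponentially fast to the mean. This makes the digits exponentially mixing, and a second
  moment estimate gives the strong law directly, without an ergodic theorem.
\<close>

section \<open>A strong law for exponentially mixing events\<close>

text \<open>In the usual distance the branch t -> 1 / (1 + t) has derivative -1 at 0, so a single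
  step need not contract uniformly. In the coordinate ln (1 + x) the ratio is at most 1/2, attained
  infinitesimally at this very point. In the same coordinate an affine function \<alpha> x + \<beta>
  with 0 \<le> \<alpha> \<le> \<beta> varies by at most exp (distance), and a weight is built from
  four such factors: this is the 4. Any distortion K > 8 is improved by K -> 4 + K / 2; with K = 16
  the numbers 4, 12, 16 are multiples of one unit, and [0,1] has diameter ln 2, so the bounds come
  out as powers of two. The indicator of a cell has no finite distortion, but one application of the
  operator turns it into a weight, which has. The interval (1,2) for \<alpha> makes the zeroth term
  equal to 1, so that the orbit starts at x = \<alpha> - 1. The invariant density is positive on all
  of [0,1], so sets that are null for the invariant measure are Lebesgue null there.\<close>

lemma tendsto_average_of_squares:
  fixes S :: "nat \<Rightarrow> real"
  assumes mono: "mono S" and nonneg: "0 \<le> S 0"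
    and lim: "(\<lambda>m. S ((Suc m)\<^sup>2) / real ((Suc m)\<^sup>2)) \<longlonglongrightarrow> p"
  shows "(\<lambda>N. S N / real N) \<longlonglongrightarrow> p"
proof -
  have sq: "filterlim (\<lambda>N. floor_sqrt N) at_top sequentially"
  proof (subst filterlim_at_top, intro allI)
    fix Z
    show "\<forall>\<^sub>F x in sequentially. Z \<le> floor_sqrt x"
      using eventually_ge_at_top[of "Z\<^sup>2"] by eventually_elim (simp add: le_floor_sqrt_iff)
  qed
  have lim0: "(\<lambda>m. S (m\<^sup>2) / real (m\<^sup>2)) \<longlonglongrightarrow> p"
    using lim by (subst (asm) filterlim_sequentially_Suc[where f = "\<lambda>m. S (m\<^sup>2) / real (m\<^sup>2)"])
  have lim1: "(\<lambda>m. S ((Suc m)\<^sup>2) / real ((Suc m)\<^sup>2) * ((real m + 1)\<^sup>2 / (real m)\<^sup>2)) \<longlonglongrightarrow> p * 1"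
    by (intro tendsto_mult lim) real_asymp
  have lim2: "(\<lambda>m. S (m\<^sup>2) / real (m\<^sup>2) * ((real m)\<^sup>2 / (real m + 1)\<^sup>2)) \<longlonglongrightarrow> p * 1"
    by (intro tendsto_mult lim0) real_asymp
  note u = filterlim_compose[OF lim1 sq, unfolded mult_1_right] and l = filterlim_compose[OF lim2 sq, unfolded mult_1_right]
  \<comment> \<open>With m = \<open>floor_sqrt N\<close>, monotonicity gives S(m^2) / (m+1)^2 \<le>
    S(N) / N \<le> S((m+1)^2) / m^2. The bounds are written with a correction factor that tends to
    1, to match \<open>lim1\<close> and \<open>lim2\<close>.\<close>
  have bnd: "S ((floor_sqrt N)\<^sup>2) / (real (floor_sqrt N))\<^sup>2 * ((real (floor_sqrt N))\<^sup>2 / (real (floor_sqrt N) + 1)\<^sup>2) \<le> S N / real N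
     \<and> S N / real N \<le> S ((Suc (floor_sqrt N))\<^sup>2) / (real (Suc (floor_sqrt N)))\<^sup>2 * ((real (floor_sqrt N) + 1)\<^sup>2 / (real (floor_sqrt N))\<^sup>2)"
    if N: "N \<ge> 1" for N
  proof -
    define m where "m = floor_sqrt N"
    have m: "m \<ge> 1" using N by (simp add: m_def le_floor_sqrt_iff)
    have 1: "m\<^sup>2 \<le> N" by (simp add: m_def)
    have 2: "N \<le> (Suc m)\<^sup>2" using Suc_floor_sqrt_power2_gt[of N] by (simp add: m_def)
    have 3: "0 \<le> S i" for i using nonneg mono by (meson le0 monoD order_trans)
    have 4: "S (m\<^sup>2) \<le> S N" "S N \<le> S ((Suc m)\<^sup>2)" using 1 2 mono by (auto dest: monoD)
    have 5: "(real m)\<^sup>2 \<le> real N" "real N \<le> (real m + 1)\<^sup>2"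
      using 1 2 of_nat_le_iff[of "m\<^sup>2" N, where 'a = real] of_nat_le_iff[of N "(Suc m)\<^sup>2", where 'a = real]
      by (auto simp: add.commute)
    have "S (m\<^sup>2) / (real m + 1)\<^sup>2 \<le> S N / real N"
      using 3 4 5 N by (intro frac_le) auto
    moreover have "S N / real N \<le> S ((Suc m)\<^sup>2) / (real m)\<^sup>2"
      using 3 4 5 m by (intro frac_le) auto
    ultimately show ?thesis
      unfolding m_def[symmetric] using m by (simp add: add.commute)
  qed
  show ?thesis
    by (rule tendsto_sandwich[OF eventually_mono[OF eventually_ge_at_top[of 1]]
          eventually_mono[OF eventually_ge_at_top[of 1]] l u]) (use bnd in \<open>simp_all only: of_nat_power\<close>)
qed

text \<open>Distinct exponents make the sum a part of the full geometric series. It is applied to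
  half a row of a covariance matrix, with \<open>g\<close> the distance to the diagonal.\<close>

lemma sum_power_inj_le:
  fixes q :: real
  assumes "0 \<le> q" "q < 1" "finite A" "inj_on g A"
  shows "(\<Sum>j\<in>A. q ^ g j) \<le> 1 / (1 - q)"
proof -
  have "(\<Sum>j\<in>A. q ^ g j) = (\<Sum>d\<in>g ` A. q ^ d)"
    using assms by (simp add: sum.reindex)
  also have "\<dots> \<le> (\<Sum>d. q ^ d)"
    using assms by (intro sum_le_suminf) auto
  also have "\<dots> = 1 / (1 - q)"
    using assms by (simp add: suminf_geometric)
  finally show ?thesis .
qed

context prob_space
begin

text \<open>The square expands into the sum of all covariances. Their geometric decay away from the
  diagonal bounds every row sum independently of N, so the moment grows linearly in N instead of
  quadratically.\<close>

lemma second_moment_centered_indicator_sum: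
  fixes p C q :: real
  assumes E: "\<And>i. E i \<in> events" and p: "\<And>i. prob (E i) = p"
    and mix: "\<And>i d. \<bar>prob (E i \<inter> E (i + d)) - p\<^sup>2\<bar> \<le> C * q ^ d" and q: "0 \<le> q" "q < 1"
  shows "expectation (\<lambda>x. ((\<Sum>i<N. indicator (E i) x) - real N * p)\<^sup>2) \<le> real N * (2 * C / (1 - q))"
proof -
  define X where "X i x = indicator (E i) x - p" for i x
  have X_int: "integrable M (\<lambda>x. X i x * X j x)" for i j
  proof (rule integrable_const_bound[where B = "(1 + \<bar>p\<bar>) * (1 + \<bar>p\<bar>)"])
    have "\<bar>X i x\<bar> \<le> 1 + \<bar>p\<bar>" for i x by (auto simp: X_def indicator_def)
    then show "AE x in M. norm (X i x * X j x) \<le> (1 + \<bar>p\<bar>) * (1 + \<bar>p\<bar>)"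
      by (intro AE_I2) (auto simp: abs_mult intro!: mult_mono)
  next
    show "(\<lambda>x. X i x * X j x) \<in> borel_measurable M"
      unfolding X_def using E by measurable
  qed
  have cov: "expectation (\<lambda>x. X i x * X j x) = prob (E i \<inter> E j) - p\<^sup>2" for i j
  proof -
    have "expectation (\<lambda>x. X i x * X j x) =
        expectation (\<lambda>x. indicator (E i \<inter> E j) x - p * indicator (E i) x - p * indicator (E j) x + p\<^sup>2)"
      unfolding X_def by (rule Bochner_Integration.integral_cong) (auto simp: indicator_def power2_eq_square algebra_simps)
    also have "\<dots> = prob (E i \<inter> E j) - p * prob (E i) - p * prob (E j) + p\<^sup>2"
      using E by (simp add: Int_absorb1 sets.sets_into_space emeasure_eq_measure prob_space)
    finally show ?thesis by (simp add: p power2_eq_square algebra_simps)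
  qed
  have C: "0 \<le> C" using mix[of 0 0] by simp
  \<comment> \<open>The two halves of the row overlap on the diagonal; the double count is harmless
    because \<open>C\<close> is nonnegative. On each half the exponents are distinct.\<close>
  have cov_le: "expectation (\<lambda>x. X i x * X j x) \<le>
      (if j \<le> i then C * q ^ (i - j) else 0) + (if i \<le> j then C * q ^ (j - i) else 0)" for i j
  proof (cases "i \<le> j")
    case True
    then have "\<bar>prob (E i \<inter> E j) - p\<^sup>2\<bar> \<le> C * q ^ (j - i)" using mix[of i "j - i"] by simp
    then show ?thesis using True C by (auto simp: cov)
  next
    case False
    then have "\<bar>prob (E i \<inter> E j) - p\<^sup>2\<bar> \<le> C * q ^ (i - j)" using mix[of j "i - j"] by (simp add: Int_commute)
    then show ?thesis using False by (auto simp: cov)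
  qed
  have row: "(\<Sum>j<N. expectation (\<lambda>x. X i x * X j x)) \<le> 2 * C / (1 - q)" for i
  proof -
    have "(\<Sum>j<N. expectation (\<lambda>x. X i x * X j x)) \<le>
        (\<Sum>j<N. (if j \<le> i then C * q ^ (i - j) else 0) + (if i \<le> j then C * q ^ (j - i) else 0))"
      by (intro sum_mono cov_le)
    also have "\<dots> = C * (\<Sum>j\<in>{j\<in>{..<N}. j \<le> i}. q ^ (i - j)) + C * (\<Sum>j\<in>{j\<in>{..<N}. i \<le> j}. q ^ (j - i))"
      unfolding sum.distrib sum_distrib_left by (simp only: sum.inter_filter finite_lessThan)
    also have "\<dots> \<le> C * (1 / (1 - q)) + C * (1 / (1 - q))"
      using C q by (intro add_mono mult_left_mono sum_power_inj_le) (auto simp: inj_on_def)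
    finally show ?thesis by simp
  qed
  have "expectation (\<lambda>x. ((\<Sum>i<N. indicator (E i) x) - real N * p)\<^sup>2) =
      expectation (\<lambda>x. \<Sum>i<N. \<Sum>j<N. X i x * X j x)"
    by (rule Bochner_Integration.integral_cong)
       (simp_all add: X_def sum_subtractf power2_eq_square sum_product[symmetric])
  also have "\<dots> = (\<Sum>i<N. \<Sum>j<N. expectation (\<lambda>x. X i x * X j x))"
    using X_int by (simp add: Bochner_Integration.integral_sum Bochner_Integration.integrable_sum)
  also have "\<dots> \<le> (\<Sum>i<N. 2 * C / (1 - q))"
    by (intro sum_mono row)
  finally show ?thesis by simp
qed

text \<open>The second moments along the squares are summable, and monotonicity of the counts fills the gaps.\<close>

theorem strong_law_of_mixing_events:
  fixes p C q :: real
  assumes E: "\<And>i. E i \<in> events" and p: "\<And>i. prob (E i) = p"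
    and mix: "\<And>i d. \<bar>prob (E i \<inter> E (i + d)) - p\<^sup>2\<bar> \<le> C * q ^ d" and q: "0 \<le> q" "q < 1"
  shows "AE x in M. (\<lambda>N. (\<Sum>i<N. indicator (E i) x) / real N) \<longlonglongrightarrow> p"
proof -
  define S where "S x N = (\<Sum>i<N. indicator (E i) x :: real)" for x N
  have [measurable]: "(\<lambda>x. S x N) \<in> borel_measurable M" for N
    unfolding S_def using E by measurable
  define K where "K = 2 * C / (1 - q)"
  define Y where "Y m x = (S x ((Suc m)\<^sup>2) / real ((Suc m)\<^sup>2) - p)\<^sup>2" for m x
  have [measurable]: "Y m \<in> borel_measurable M" for m
    unfolding Y_def by measurable
  have S_le: "0 \<le> S x N" "S x N \<le> real N" for x N
    using sum_bounded_above[of "{..<N}" "\<lambda>i. indicator (E i) x :: real" 1]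
    by (auto simp: S_def sum_nonneg indicator_def)
  have p01: "0 \<le> p" "p \<le> 1" using p[of 0] by auto
  have Y_le: "Y m x \<le> 1" for m x
  proof -
    have "S x ((Suc m)\<^sup>2) / real ((Suc m)\<^sup>2) \<in> {0..1}"
      using S_le[of x "(Suc m)\<^sup>2"] unfolding atLeastAtMost_iff
      by (intro conjI divide_nonneg_nonneg mult_imp_div_pos_le) auto
    then have "\<bar>S x ((Suc m)\<^sup>2) / real ((Suc m)\<^sup>2) - p\<bar> \<le> 1"
      using p01 unfolding atLeastAtMost_iff abs_le_iff by linarith
    then show ?thesis by (simp add: Y_def abs_square_le_1)
  qed
  have Y_nonneg: "0 \<le> Y m x" for m x by (simp add: Y_def)
  have Y_int: "integrable M (Y m)" for m
    by (rule integrable_const_bound[where B = 1]) (auto simp: Y_le Y_nonneg)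
  \<comment> \<open>Dividing the linear bound by the square of the number of terms, which is
    (m+1)^2, leaves a summable sequence; this is why squares are used.\<close>
  have EY: "expectation (Y m) \<le> K * inverse ((real (Suc m))\<^sup>2)" for m
  proof -
    define n where "n = (Suc m)\<^sup>2"
    have n: "real n > 0" by (simp add: n_def)
    have "expectation (Y m) = expectation (\<lambda>x. ((\<Sum>i<n. indicator (E i) x) - real n * p)\<^sup>2 / (real n)\<^sup>2)"
      unfolding Y_def S_def n_def[symmetric] using n
      by (intro Bochner_Integration.integral_cong) (simp_all add: power_divide[symmetric] diff_divide_distrib)
    also have "\<dots> \<le> real n * K / (real n)\<^sup>2"
      using second_moment_centered_indicator_sum[OF E p mix q, of n, folded K_def]
      by (simp add: divide_right_mono)
    also have "\<dots> = K * inverse (real n)" using n by (simp add: power2_eq_square field_simps)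
    finally show ?thesis by (simp add: n_def)
  qed
  \<comment> \<open>The series of the \<open>Y m\<close> has finite expectation, hence converges
    almost everywhere, hence its terms tend to 0 there.\<close>
  have "(\<integral>\<^sup>+x. (\<Sum>m. ennreal (Y m x)) \<partial>M) = (\<Sum>m. \<integral>\<^sup>+x. ennreal (Y m x) \<partial>M)"
    by (intro nn_integral_suminf) measurable
  also have "\<dots> = (\<Sum>m. ennreal (expectation (Y m)))"
    using Y_int Y_nonneg by (subst nn_integral_eq_integral) auto
  also have "\<dots> < \<infinity>"
  proof -
    have "summable (\<lambda>m. expectation (Y m))"
    proof (rule summable_comparison_test')
      show "summable (\<lambda>m. K * inverse ((real (Suc m))\<^sup>2))"
        using inverse_power_summable[of 2, where 'a = real]
        by (intro summable_mult) (simp only: summable_Suc_iff[of "\<lambda>m. inverse ((real m)\<^sup>2)"])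
      show "norm (expectation (Y m)) \<le> K * inverse ((real (Suc m))\<^sup>2)" for m
        using EY[of m] Y_nonneg by (simp add: integral_nonneg)
    qed
    then show ?thesis
      using Y_nonneg by (subst suminf_ennreal2) (auto simp: integral_nonneg)
  qed
  finally have "(\<integral>\<^sup>+x. (\<Sum>m. ennreal (Y m x)) \<partial>M) \<noteq> \<infinity>" by simp
  then have "AE x in M. (\<Sum>m. ennreal (Y m x)) \<noteq> \<infinity>"
    by (intro nn_integral_PInf_AE) measurable
  then show ?thesis
  proof eventually_elim
    case (elim x)
    then have "summable (\<lambda>m. Y m x)"
      using Y_nonneg by (intro summable_suminf_not_top) auto
    then have "(\<lambda>m. Y m x) \<longlonglongrightarrow> 0" by (rule summable_LIMSEQ_zero)
    then have "(\<lambda>m. sqrt (Y m x)) \<longlonglongrightarrow> 0" by (auto dest: tendsto_real_sqrt)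
    then have "(\<lambda>m. S x ((Suc m)\<^sup>2) / real ((Suc m)\<^sup>2) - p) \<longlonglongrightarrow> 0"
      by (intro tendsto_rabs_zero_cancel[of "\<lambda>m. S x ((Suc m)\<^sup>2) / real ((Suc m)\<^sup>2) - p"]) (simp add: Y_def)
    then have "(\<lambda>m. S x ((Suc m)\<^sup>2) / real ((Suc m)\<^sup>2)) \<longlonglongrightarrow> p" by (rule LIM_zero_cancel)
    moreover have "mono (S x)"
      by (intro monoI) (auto simp: S_def intro!: sum_mono2)
    ultimately have "(\<lambda>N. S x N / real N) \<longlonglongrightarrow> p"
      using S_le by (intro tendsto_average_of_squares)
    then show ?case by (simp add: S_def)
  qed
qed

end

section \<open>Branches and weights\<close>

locale clog_base =
  fixes b :: nat
  assumes b_ge2: "b \<ge> 2"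
begin

definition branch :: "nat \<Rightarrow> nat \<Rightarrow> real \<Rightarrow> real" where
  "branch a c x = 1 / (real b ^ a * (real c + x))"

text \<open>The factor \<open>h (\<phi> x) \<bar>\<phi>' x\<bar> / h x\<close> for the invariant density \<open>h\<close> and the inverse branch \<open>\<phi>\<close>.\<close>

definition weight :: "nat \<Rightarrow> nat \<Rightarrow> real \<Rightarrow> real" where
  "weight a c x = real b ^ a * (1 + x) * (real b + x) /
     ((real b ^ a * (real c + x) + 1) * (real b ^ Suc a * (real c + x) + 1))"

text \<open>The series over \<open>a\<close> has a meaningful value once it converges;
  \<open>transfer_sums\<close> secures this for \<open>f\<close> bounded on [0,1].\<close>

definition transfer :: "(real \<Rightarrow> real) \<Rightarrow> real \<Rightarrow> real" where
  "transfer f x = (\<Sum>a. \<Sum>c\<in>{1..<b}. weight a c x * f (branch a c x))"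

definition ldist :: "real \<Rightarrow> real \<Rightarrow> real" where
  "ldist x y = \<bar>ln (1 + x) - ln (1 + y)\<bar>"

lemma b_gt0: "real b > 0" and b_ge2': "real b \<ge> 2"
  using b_ge2 by auto

lemma bpow_ge1: "real b ^ a \<ge> 1"
  using b_ge2 by simp

lemma branch_in_unit:
  assumes "x \<in> {0..1}" "c \<ge> 1"
  shows "branch a c x \<in> {0..1}"
proof -
  have "1 * 1 \<le> real b ^ a * (real c + x)"
    using assms bpow_ge1 by (intro mult_mono) auto
  then show ?thesis by (simp add: branch_def)
qed

lemma weight_nonneg: "x \<in> {0..1} \<Longrightarrow> 0 \<le> weight a c x"
  unfolding weight_def by auto

text \<open>Partial fractions in the variable c + x. The bracket is a difference between consecutive
  values of \<open>a\<close>, which makes the sum over all branches computable.\<close>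

lemma weight_telescoping:
  assumes "x \<in> {0..1}" "c \<ge> 1"
  shows "weight a c x = (1 + x) * (real b + x) / (real b - 1) *
    (1 / (real c + x + 1 / real b ^ Suc a) - 1 / (real c + x + 1 / real b ^ a))"
proof -
  define s where "s = real c + x"
  define B where "B = real b"
  define p where "p = B ^ a"
  have s: "s > 0" using assms by (simp add: s_def)
  have B: "B \<ge> 2" using b_ge2 by (simp add: B_def)
  have p: "p \<ge> 1" using bpow_ge1 by (simp add: p_def B_def)
  have pos: "p * s + 1 > 0" "B * p * s + 1 > 0" using s B p by (auto intro!: add_pos_pos mult_pos_pos)
  have 1: "1 / (s + 1 / p) = p / (p * s + 1)"
    using p pos by (simp add: field_simps)
  have 2: "1 / (s + 1 / (B * p)) = (B * p) / (B * p * s + 1)"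
    using p B pos by (simp add: field_simps)
  have "1 / (s + 1 / (B * p)) - 1 / (s + 1 / p) = (B - 1) * p / ((p * s + 1) * (B * p * s + 1))"
    unfolding 1 2 using pos by (simp add: diff_frac_eq) (simp add: algebra_simps)
  then show ?thesis
    unfolding weight_def power_Suc s_def[symmetric] B_def[symmetric] p_def[symmetric]
    using B by (simp add: mult.assoc)
qed

text \<open>Two telescopings: over \<open>a\<close> each c leaves 1 / (c + x) - 1 / (c + 1 + x), and
  over c there remains 1 / (1 + x) - 1 / (b + x), which cancels the prefactor. This identity is the
  invariance of the density in pointwise form.\<close>

lemma weight_sums:
  assumes "x \<in> {0..1}"
  shows "(\<lambda>a. \<Sum>c\<in>{1..<b}. weight a c x) sums 1"
proof -
  define u where "u c a = 1 / (real c + x + 1 / real b ^ a)" for c a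
  have lim: "u c \<longlonglongrightarrow> 1 / (real c + x + 0)" if "c \<ge> 1" for c
    unfolding u_def using that assms b_ge2
    by (intro tendsto_intros LIMSEQ_divide_realpow_zero) auto
  have "(\<lambda>a. \<Sum>c\<in>{1..<b}. (1 + x) * (real b + x) / (real b - 1) * (u c (Suc a) - u c a)) sums
      (\<Sum>c\<in>{1..<b}. (1 + x) * (real b + x) / (real b - 1) * (1 / (real c + x + 0) - u c 0))"
    by (intro sums_sum sums_mult telescope_sums lim) auto
  moreover have "(\<Sum>c\<in>{1..<b}. weight a c x) =
      (\<Sum>c\<in>{1..<b}. (1 + x) * (real b + x) / (real b - 1) * (u c (Suc a) - u c a))" for a
    by (rule sum.cong) (use assms in \<open>auto simp: weight_telescoping u_def\<close>)
  moreover have "(\<Sum>c\<in>{1..<b}. (1 + x) * (real b + x) / (real b - 1) * (1 / (real c + x + 0) - u c 0)) = 1"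
  proof -
    have "(\<Sum>c\<in>{1..<b}. 1 / (real c + x + 0) - u c 0) = (\<Sum>c\<in>{1..<b}. 1 / (real c + x) - 1 / (real (Suc c) + x))"
      by (simp add: u_def add_ac)
    also have "\<dots> = 1 / (1 + x) - 1 / (real b + x)"
      using sum_Suc_diff'[of 1 b "\<lambda>c. - (1 / (real c + x))"] b_ge2 by simp
    also have "\<dots> = (real b - 1) / ((1 + x) * (real b + x))"
      using assms b_ge2 by (simp add: diff_frac_eq)
    finally show ?thesis
      unfolding sum_distrib_left[symmetric] using assms b_ge2' by (simp add: add_nonneg_eq_0_iff)
  qed
  ultimately show ?thesis by simp
qed

section \<open>Contraction and bounded distortion in the logarithmic distance\<close>

lemma ldist_comm: "ldist x y = ldist y x"
  by (simp add: ldist_def)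

lemma ldist_le_ln2:
  assumes "x \<in> {0..1}" "y \<in> {0..1}"
  shows "ldist x y \<le> ln 2"
proof -
  have "0 \<le> ln (1 + z) \<and> ln (1 + z) \<le> ln 2" if "z \<in> {0..1}" for z :: real
    using that by auto
  from this[OF assms(1)] this[OF assms(2)] show ?thesis
    by (auto simp: ldist_def abs_le_iff)
qed

text \<open>Written as \<alpha> (1 + x) + (\<beta> - \<alpha>), the function has nonnegative
  coefficients in 1 + x, so it grows by a factor of at most (1 + x) / (1 + y) when y < x.\<close>

lemma affine_le_exp_ldist:
  assumes "x \<in> {0..1}" "y \<in> {0..1}" "0 \<le> \<alpha>" "\<alpha> \<le> \<beta>"
  shows "\<alpha> * x + \<beta> \<le> exp (ldist x y) * (\<alpha> * y + \<beta>)"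
proof (cases "x \<le> y")
  case True
  have "\<alpha> * x + \<beta> \<le> 1 * (\<alpha> * y + \<beta>)" using True assms by (simp add: mult_left_mono)
  also have "\<dots> \<le> exp (ldist x y) * (\<alpha> * y + \<beta>)"
    using assms by (intro mult_right_mono) (auto simp: ldist_def)
  finally show ?thesis .
next
  case False
  then have "ldist x y = ln ((1 + x) / (1 + y))"
    using assms by (auto simp: ldist_def ln_div)
  then have "exp (ldist x y) = (1 + x) / (1 + y)" using assms by simp
  moreover have "(\<alpha> * x + \<beta>) * (1 + y) \<le> (1 + x) * (\<alpha> * y + \<beta>)"
  proof -
    have "0 \<le> (\<beta> - \<alpha>) * (x - y)" using False assms by simp
    then show ?thesis by (simp add: algebra_simps)
  qed
  moreover have "1 + y > 0" using assms by simp
  ultimately show ?thesis by (simp add: pos_le_divide_eq)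
qed

lemma branch_contracts:
  assumes "x \<in> {0..1}" "y \<in> {0..1}" "c \<ge> 1"
  shows "ldist (branch a c x) (branch a c y) \<le> ldist x y / 2"
  using assms(1,2)
proof (induction x y rule: linorder_wlog)
  case (sym x y)
  then show ?case by (simp add: ldist_comm)
next
  case (le x y)
  define p where "p = real b ^ a"
  have p: "p \<ge> 1" using bpow_ge1 by (simp add: p_def)
  \<comment> \<open>Branches are decreasing, so for x \<le> y the claim with its absolute values
    resolved is exactly \<open>F x \<le> F y\<close>.\<close>
  define F where "F u = 2 * ln (1 + 1 / (p * (real c + u))) + ln (1 + u)" for u
  have pos: "p * (real c + u) > 0" if "0 \<le> u" for u
    using that p assms by (intro mult_pos_pos) auto
  have "F x \<le> F y"
  proof (rule DERIV_nonneg_imp_nondecreasing[OF le(1)])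
    fix u assume u: "x \<le> u" "u \<le> y"
    then have u0: "0 \<le> u" using le by simp
    define v where "v = real c + u"
    have v: "v \<ge> 1 + u" "v > 0" using assms u0 by (auto simp: v_def)
    have deriv: "(F has_real_derivative 2 * ((- p / (p * v)\<^sup>2) / (1 + 1 / (p * v))) + 1 / (1 + u)) (at u)"
    proof -
      have "p * (real c + u) \<noteq> 0" "1 + 1 / (p * (real c + u)) > 0" "1 + u > 0"
        using pos[OF u0] u0 by (auto intro!: add_pos_pos)
      then show ?thesis
        unfolding F_def v_def power2_eq_square by (auto intro!: derivative_eq_intros)
    qed
    have "p / (p * v)\<^sup>2 / (1 + 1 / (p * v)) = 1 / (v * (p * v + 1))"
      using p v pos[OF u0, folded v_def] by (simp add: power2_eq_square divide_simps)
    \<comment> \<open>From v \<ge> 1 + u and p v \<ge> 1. Equality occurs for p = 1, c = 1, u = 0,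
      so the ratio 1/2 cannot be improved.\<close>
    moreover have "1 / (v * (p * v + 1)) \<le> 1 / (1 + u) / 2"
    proof -
      have "1 * 1 \<le> p * v" using p v u0 by (intro mult_mono) auto
      then have "(1 + u) * 2 \<le> v * (p * v + 1)" using v u0 by (intro mult_mono) auto
      then show ?thesis using u0 unfolding divide_divide_eq_left
        by (intro divide_left_mono mult_pos_pos) (use v p in \<open>auto intro!: add_pos_pos\<close>)
    qed
    ultimately have "p / (p * v)\<^sup>2 / (1 + 1 / (p * v)) \<le> 1 / (1 + u) / 2" by simp
    moreover have "0 \<le> 2 * (- A) + B" if "A \<le> B / 2" for A B :: real using that by simp
    ultimately have "0 \<le> 2 * ((- p / (p * v)\<^sup>2) / (1 + 1 / (p * v))) + 1 / (1 + u)"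
      unfolding minus_divide_left[symmetric] by blast
    with deriv show "\<exists>d. (F has_real_derivative d) (at u) \<and> 0 \<le> d"
      by blast
  qed
  moreover have "ln (1 + 1 / (p * (real c + y))) \<le> ln (1 + 1 / (p * (real c + x)))"
    using le pos[of x] pos[of y] p
    by (intro ln_mono add_left_mono divide_left_mono mult_left_mono mult_pos_pos)
      (use assms in \<open>auto intro!: add_pos_nonneg\<close>)
  moreover have "ln (1 + x) \<le> ln (1 + y)" using le by (intro ln_mono) auto
  ultimately show ?case
    unfolding ldist_def branch_def p_def[symmetric] F_def by (simp add: abs_if)
qed

text \<open>Apart from the constant b^a, a weight has two affine factors in the numerator and two in
  the denominator, and each costs one factor exp (\<open>ldist x y\<close>). In the denominators c
  \<ge> 1 keeps the slope below the constant term.\<close>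

lemma weight_distortion:
  assumes "x \<in> {0..1}" "y \<in> {0..1}" "c \<ge> 1"
  shows "weight a c x \<le> exp (4 * ldist x y) * weight a c y"
proof -
  define e where "e = exp (ldist x y)"
  define p where "p = real b ^ a"
  have p: "p \<ge> 1" using bpow_ge1 by (simp add: p_def)
  have bp: "p \<le> real b * p" using p b_ge2' by simp
  have pc: "p \<le> p * real c" using p assms by simp
  have e: "e > 0" by (simp add: e_def)
  define n1 where "n1 z = 1 + z" for z :: real
  define n2 where "n2 z = real b + z" for z :: real
  define d1 where "d1 z = p * (real c + z) + 1" for z :: real
  define d2 where "d2 z = real b * p * (real c + z) + 1" for z :: real
  have n: "n1 x \<le> e * n1 y" "n2 x \<le> e * n2 y"
    using affine_le_exp_ldist[OF assms(1,2), of 1 1] affine_le_exp_ldist[OF assms(1,2), of 1 "real b"] b_ge2'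
    by (auto simp: e_def n1_def n2_def add_ac)
  have d: "d1 y \<le> e * d1 x"
    using affine_le_exp_ldist[OF assms(2,1), of p "p * real c + 1"] p pc
    by (simp add: e_def d1_def ldist_comm algebra_simps)
  have "real b * p * 1 \<le> real b * p * real c"
    using assms p b_ge2' by (intro mult_left_mono) auto
  then have bpc: "real b * p \<le> real b * p * real c + 1" by linarith
  have d': "d2 y \<le> e * d2 x"
    using affine_le_exp_ldist[OF assms(2,1) _ bpc] p b_ge2'
    by (simp add: e_def d2_def ldist_comm algebra_simps)
  have pos: "n1 z > 0" "n2 z > 0" "d1 z > 0" "d2 z > 0" if "z \<in> {0..1}" for z
    using that p b_ge2' by (auto simp: n1_def n2_def d1_def d2_def intro!: add_pos_pos add_nonneg_pos mult_nonneg_nonneg)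
  have w: "weight a c z = p * (n1 z * n2 z) / (d1 z * d2 z)" for z
    by (simp add: weight_def n1_def n2_def d1_def d2_def p_def mult_ac)
  have "n1 x * n2 x * (d1 y * d2 y) \<le> (e * n1 y) * (e * n2 y) * ((e * d1 x) * (e * d2 x))"
    using n d d' pos[OF assms(1)] pos[OF assms(2)] e by (intro mult_mono) (auto intro!: less_imp_le)
  also have "\<dots> = e ^ 4 * (n1 y * n2 y * (d1 x * d2 x))" by (simp add: power_numeral_reduce algebra_simps)
  finally have "p * (n1 x * n2 x * (d1 y * d2 y)) \<le> p * (e ^ 4 * (n1 y * n2 y * (d1 x * d2 x)))"
    using p by (intro mult_left_mono) auto
  then have "weight a c x \<le> e ^ 4 * weight a c y"
    unfolding w using pos[OF assms(1)] pos[OF assms(2)] by (simp add: field_simps)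
  also have "e ^ 4 = exp (4 * ldist x y)"
    using exp_of_nat_mult[of 4 "ldist x y"] by (simp add: e_def)
  finally show ?thesis .
qed

section \<open>The cone of functions of bounded distortion\<close>

definition distortion_cone :: "real \<Rightarrow> (real \<Rightarrow> real) set" where
  "distortion_cone K = {f. \<forall>x\<in>{0..1}. 0 \<le> f x \<and> (\<forall>y\<in>{0..1}. f x \<le> exp (K * ldist x y) * f y)}"

lemma coneI:
  assumes "\<And>x. x \<in> {0..1} \<Longrightarrow> 0 \<le> f x"
    and "\<And>x y. x \<in> {0..1} \<Longrightarrow> y \<in> {0..1} \<Longrightarrow> f x \<le> exp (K * ldist x y) * f y"
  shows "f \<in> distortion_cone K"
  using assms by (auto simp: distortion_cone_def)

lemma coneD:
  assumes "f \<in> distortion_cone K" "x \<in> {0..1}"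
  shows "0 \<le> f x" "y \<in> {0..1} \<Longrightarrow> f x \<le> exp (K * ldist x y) * f y"
  using assms by (auto simp: distortion_cone_def)

lemma cone_mono:
  assumes "K \<le> K'" "f \<in> distortion_cone K"
  shows "f \<in> distortion_cone K'"
proof (rule coneI)
  fix x y :: real assume xy: "x \<in> {0..1}" "y \<in> {0..1}"
  show "0 \<le> f x" using coneD assms xy by auto
  have "f x \<le> exp (K * ldist x y) * f y" using coneD assms xy by auto
  also have "\<dots> \<le> exp (K' * ldist x y) * f y"
    using assms xy by (intro mult_right_mono coneD[OF assms(2)]) (auto intro!: mult_right_mono simp: ldist_def)
  finally show "f x \<le> exp (K' * ldist x y) * f y" .
qed

text \<open>The diameter of [0,1] for \<open>ldist\<close> is ln 2, so each unit of distortion costs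
  a factor 2 in the ratio of two values. The later constants 2^12 and 2^16 come from here.\<close>

lemma cone_le_pow2:
  assumes "f \<in> distortion_cone (real k)" "x \<in> {0..1}" "y \<in> {0..1}"
  shows "f x \<le> 2 ^ k * f y"
proof -
  have "f x \<le> exp (real k * ldist x y) * f y" using coneD assms by auto
  also have "\<dots> \<le> exp (real k * ln 2) * f y"
    using assms ldist_le_ln2 by (intro mult_right_mono coneD[OF assms(1)]) (auto intro!: mult_left_mono)
  also have "exp (real k * ln 2) = (2::real) ^ k" by (simp add: exp_of_nat_mult)
  finally show ?thesis .
qed

lemma transfer_sums:
  assumes x: "x \<in> {0..1}" and bnd: "\<And>y. y \<in> {0..1} \<Longrightarrow> \<bar>f y\<bar> \<le> B"
  shows "(\<lambda>a. \<Sum>c\<in>{1..<b}. weight a c x * f (branch a c x)) sums transfer f x"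
  unfolding transfer_def
proof (rule summable_sums, rule summable_comparison_test')
  show "summable (\<lambda>a. B * (\<Sum>c\<in>{1..<b}. weight a c x))"
    using weight_sums[OF x] by (intro summable_mult) (simp add: sums_iff)
  fix a
  have "norm (\<Sum>c\<in>{1..<b}. weight a c x * f (branch a c x)) \<le> (\<Sum>c\<in>{1..<b}. weight a c x * B)"
  proof (rule sum_norm_le)
    fix c assume "c \<in> {1..<b}"
    then have "\<bar>f (branch a c x)\<bar> \<le> B" by (intro bnd branch_in_unit x) simp
    then show "norm (weight a c x * f (branch a c x)) \<le> weight a c x * B"
      using weight_nonneg[OF x] by (simp add: abs_mult mult_left_mono)
  qed
  then show "norm (\<Sum>c\<in>{1..<b}. weight a c x * f (branch a c x)) \<le> B * (\<Sum>c\<in>{1..<b}. weight a c x)"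
    by (simp add: sum_distrib_left mult.commute)
qed

lemma cone_bounded:
  assumes "f \<in> distortion_cone K"
  obtains B where "\<And>y. y \<in> {0..1} \<Longrightarrow> \<bar>f y\<bar> \<le> B"
proof -
  obtain k :: nat where k: "K \<le> real k" using real_arch_simple by blast
  then have "\<bar>f y\<bar> \<le> 2 ^ k * f 0" if "y \<in> {0..1}" for y
    using cone_le_pow2[OF cone_mono[OF k assms] that] coneD(1)[OF assms that] by auto
  then show thesis using that by blast
qed

text \<open>The weights sum to 1, so constants are fixed by the operator; a constant that has been
  split off can therefore be carried through the iteration.\<close>

lemma transfer_diff_const:
  assumes x: "x \<in> {0..1}" and bnd: "\<And>y. y \<in> {0..1} \<Longrightarrow> \<bar>f y\<bar> \<le> B"
  shows "transfer (\<lambda>x. f x - t) x = transfer f x - t"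
proof -
  have "(\<lambda>a. (\<Sum>c\<in>{1..<b}. weight a c x * f (branch a c x)) - (\<Sum>c\<in>{1..<b}. weight a c x) * t)
      sums (transfer f x - 1 * t)"
    by (intro sums_diff transfer_sums[OF x bnd] sums_mult2 weight_sums[OF x])
  moreover have "(\<lambda>a. \<Sum>c\<in>{1..<b}. weight a c x * (f (branch a c x) - t)) sums transfer (\<lambda>x. f x - t) x"
  proof (rule transfer_sums[OF x])
    show "\<bar>f y - t\<bar> \<le> B + \<bar>t\<bar>" if "y \<in> {0..1}" for y
      using bnd[OF that] by linarith
  qed
  ultimately show ?thesis
    by (simp add: right_diff_distrib sum_subtractf sum_distrib_right sums_unique2)
qed

lemma transfer_cone:
  assumes f: "f \<in> distortion_cone K" and K: "0 \<le> K"
  shows "transfer f \<in> distortion_cone (4 + K / 2)"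
proof (rule coneI)
  fix x y :: real assume x: "x \<in> {0..1}" and y: "y \<in> {0..1}"
  obtain B where B: "\<And>y. y \<in> {0..1} \<Longrightarrow> \<bar>f y\<bar> \<le> B" using cone_bounded[OF f] by blast
  note sx = transfer_sums[OF x B] and sy = transfer_sums[OF y B]
  show "0 \<le> transfer f x"
    using weight_nonneg[OF x] coneD(1)[OF f] branch_in_unit[OF x]
    by (intro sums_le[OF _ sums_zero sx] sum_nonneg mult_nonneg_nonneg) auto
  have term_le: "weight a c x * f (branch a c x) \<le> exp ((4 + K / 2) * ldist x y) * (weight a c y * f (branch a c y))"
    if c: "c \<in> {1..<b}" for a c
  proof -
    have bx: "branch a c x \<in> {0..1}" and bz: "branch a c y \<in> {0..1}"
      using c branch_in_unit x y by auto
    have "f (branch a c x) \<le> exp (K * ldist (branch a c x) (branch a c y)) * f (branch a c y)"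
      by (rule coneD(2)[OF f bx bz])
    also have "\<dots> \<le> exp (K * (ldist x y / 2)) * f (branch a c y)"
      using mult_left_mono[OF branch_contracts[OF x y, of c a] K] c
      by (intro mult_right_mono coneD(1)[OF f bz]) auto
    finally have "weight a c x * f (branch a c x) \<le>
        (exp (4 * ldist x y) * weight a c y) * (exp (K * (ldist x y / 2)) * f (branch a c y))"
      using c by (intro mult_mono weight_distortion x y coneD(1)[OF f bx]) (auto intro!: mult_nonneg_nonneg weight_nonneg y)
    then show ?thesis by (simp add: exp_add ring_distribs mult_ac)
  qed
  show "transfer f x \<le> exp ((4 + K / 2) * ldist x y) * transfer f y"
    by (rule sums_le[OF _ sx sums_mult[OF sy]]) (unfold sum_distrib_left, intro sum_mono term_le)
qed

text \<open>With e = exp (4 \<open>ldist x y\<close>) one has f x \<le> e^3 f y, and the claim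
  reduces to t (e^4 - 1) \<le> f y (e^4 - e^3). Since e^4 - 1 is e - 1 times four powers of e, each
  at most e^3, the condition 4 t \<le> f y suffices.\<close>

lemma cone_12_minus_const:
  assumes f: "f \<in> distortion_cone 12" and t: "0 \<le> t" "\<And>x. x \<in> {0..1} \<Longrightarrow> 4 * t \<le> f x"
  shows "(\<lambda>x. f x - t) \<in> distortion_cone 16"
proof (rule coneI)
  fix x y :: real assume x: "x \<in> {0..1}" and y: "y \<in> {0..1}"
  show "0 \<le> f x - t" using t x by force
  define e where "e = exp (4 * ldist x y)"
  have e1: "e \<ge> 1" by (simp add: e_def ldist_def)
  have e3: "exp (12 * ldist x y) = e ^ 3" "exp (16 * ldist x y) = e ^ 4"
    using exp_of_nat_mult[of 3 "4 * ldist x y"] exp_of_nat_mult[of 4 "4 * ldist x y"] by (auto simp: e_def)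
  have "t * (e ^ 4 - 1) = t * ((e - 1) * (e ^ 3 + e ^ 2 + e + 1))"
    by (simp add: power_numeral_reduce algebra_simps)
  also have "\<dots> \<le> t * ((e - 1) * (e ^ 3 + e ^ 3 + e ^ 3 + e ^ 3))"
    using e1 t power_increasing[of 2 3 e] power_increasing[of 1 3 e] power_increasing[of 0 3 e]
    by (intro mult_left_mono add_mono) auto
  also have "\<dots> = (4 * t) * (e ^ 4 - e ^ 3)"
    by (simp add: power_numeral_reduce algebra_simps)
  also have "\<dots> \<le> f y * (e ^ 4 - e ^ 3)"
    using e1 t y by (intro mult_right_mono) (auto simp: power_increasing)
  finally have "e ^ 3 * f y - t \<le> e ^ 4 * (f y - t)" by (simp add: algebra_simps)
  moreover have "f x \<le> e ^ 3 * f y" using coneD(2)[OF f x y] e3 by simp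
  ultimately show "f x - t \<le> exp (16 * ldist x y) * (f y - t)" unfolding e3 by linarith
qed

text \<open>This is the starting point of the iteration: \<open>weight a c\<close> is what the
  operator makes of the indicator of a cell, which itself lies in no cone.\<close>

lemma weight_cone: "c \<ge> 1 \<Longrightarrow> weight a c \<in> distortion_cone 16"
  by (rule cone_mono[of 4]) (auto intro!: coneI weight_nonneg weight_distortion)

end

section \<open>Digits and the invariant measure\<close>

lemma clog_digits_eqI:
  assumes b: "b \<ge> 2" and c: "c \<in> {1..<b}"
    and y: "real c * real b ^ a \<le> y" "y < (real c + 1) * real b ^ a"
  shows "clog_exponent b y = int a" "clog_coeff b y = int c"
proof -
  have p: "real b ^ a > 0" using b by simp
  have "1 * real b ^ a \<le> real c * real b ^ a" using c p by (intro mult_right_mono) auto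
  then have ge: "real b ^ a \<le> y" using y by linarith
  have "(real c + 1) * real b ^ a \<le> real b * real b ^ a" using c p by (intro mult_right_mono) auto
  then have lt: "y < real b ^ Suc a" using y by simp
  have "y > 0" using ge p by linarith
  then have "real a \<le> log (real b) y" "log (real b) y < real (Suc a)"
    using ge lt b by (auto simp: le_log_iff log_less_iff powr_realpow[symmetric] simp del: power_Suc)
  then show e: "clog_exponent b y = int a"
    unfolding clog_exponent_def by (intro floor_unique) auto
  show "clog_coeff b y = int c"
    unfolding clog_coeff_def e using y p by (intro floor_unique) (auto simp: field_simps)
qed

lemma clog_digits_exist:
  assumes b: "b \<ge> 2" and y: "y \<ge> 1"
  obtains a c where "c \<in> {1..<b}" "real c * real b ^ a \<le> y" "y < (real c + 1) * real b ^ a"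
proof -
  define a where "a = nat \<lfloor>log (real b) y\<rfloor>"
  define p where "p = real b ^ a"
  define c where "c = nat \<lfloor>y / p\<rfloor>"
  have p: "p > 0" using b by (simp add: p_def)
  have "log (real b) y \<ge> 0" using b y by simp
  then have "real a \<le> log (real b) y" "log (real b) y < real (Suc a)"
    unfolding a_def by linarith+
  then have "real b powr real a \<le> y" "y < real b powr real (Suc a)"
    using b y by (auto simp: le_log_iff log_less_iff simp del: of_nat_Suc)
  then have ge: "p \<le> y" and lt: "y < real b * p"
    using b by (auto simp: powr_realpow p_def simp del: of_nat_Suc)
  have 1: "1 \<le> y / p" "y / p < real b" using ge lt p by (auto simp: field_simps)
  then have c: "real c \<le> y / p" "y / p < real c + 1" unfolding c_def by linarith+
  have "real c < real b" "real c > 0" using c 1 by linarith+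
  then show thesis
    using that[of c a] c p by (auto simp: p_def[symmetric] field_simps)
qed

context clog_base
begin

text \<open>If x = 1 / y, the value is the reciprocal of the next term of the process; the value 0
  corresponds to termination.\<close>

definition gauss_map :: "real \<Rightarrow> real" where
  "gauss_map x = 1 / x / real b powi clog_exponent b (1 / x) - real_of_int (clog_coeff b (1 / x))"

text \<open>Open on the left and closed on the right, because c \<le> y / b^a < c + 1 is reversed by
  x = 1 / y. The left endpoint is the image of t = 1 under the branch.\<close>

definition cell :: "nat \<Rightarrow> nat \<Rightarrow> real set" where
  "cell a c = {1 / (real b ^ a * (real c + 1))<..1 / (real b ^ a * real c)}"

lemma mem_cell_iff:
  assumes "c \<ge> 1" "x > 0"
  shows "x \<in> cell a c \<longleftrightarrow> real c * real b ^ a \<le> 1 / x \<and> 1 / x < (real c + 1) * real b ^ a"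
proof -
  define p where "p = real b ^ a"
  have "p * real c > 0" "p * (real c + 1) > 0" using b_gt0 assms by (auto simp: p_def)
  then show ?thesis using assms(2)
    unfolding cell_def greaterThanAtMost_iff p_def[symmetric]
    by (simp only: pos_divide_less_eq pos_le_divide_eq) (auto simp: mult_ac)
qed

lemma mem_cell_iff_digits:
  assumes c: "c \<in> {1..<b}" and x: "0 < x" "x \<le> 1"
  shows "x \<in> cell a c \<longleftrightarrow> clog_exponent b (1 / x) = int a \<and> clog_coeff b (1 / x) = int c"
proof
  assume "x \<in> cell a c"
  then have "real c * real b ^ a \<le> 1 / x" "1 / x < (real c + 1) * real b ^ a"
    using c x mem_cell_iff[of c x a] by auto
  then show "clog_exponent b (1 / x) = int a \<and> clog_coeff b (1 / x) = int c"
    using clog_digits_eqI[OF b_ge2 c] by blast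
next
  assume r: "clog_exponent b (1 / x) = int a \<and> clog_coeff b (1 / x) = int c"
  have "1 / x \<ge> 1" using x by simp
  then obtain a' c' where *: "c' \<in> {1..<b}" "real c' * real b ^ a' \<le> 1 / x" "1 / x < (real c' + 1) * real b ^ a'"
    using clog_digits_exist[OF b_ge2] by blast
  with r have "a' = a" "c' = c" using clog_digits_eqI[OF b_ge2 *] by auto
  with * c x show "x \<in> cell a c" by (simp add: mem_cell_iff)
qed

lemma unit_in_cell:
  assumes "0 < x" "x \<le> 1"
  obtains a c where "c \<in> {1..<b}" "x \<in> cell a c"
proof -
  have "1 / x \<ge> 1" using assms by simp
  then obtain a c where *: "c \<in> {1..<b}" "real c * real b ^ a \<le> 1 / x" "1 / x < (real c + 1) * real b ^ a"
    using clog_digits_exist[OF b_ge2] by blast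
  then show thesis using that[of c a] assms by (simp add: mem_cell_iff)
qed

lemma cell_subset_unit: "c \<ge> 1 \<Longrightarrow> cell a c \<subseteq> {0<..1}"
proof
  fix x assume c: "c \<ge> 1" and x: "x \<in> cell a c"
  have "1 * 1 \<le> real b ^ a * real c" using c bpow_ge1 by (intro mult_mono) auto
  then have "1 / (real b ^ a * real c) \<le> 1" by simp
  moreover have "0 < 1 / (real b ^ a * (real c + 1))" using b_gt0 c by simp
  ultimately show "x \<in> {0<..1}"
    using x unfolding cell_def greaterThanAtMost_iff by (meson order_less_trans order_trans)
qed

text \<open>Existence and uniqueness of the digits, cast as a partition of unity in
  \<open>ennreal\<close> so that it can be inserted under an integral and exchanged with it.\<close>

lemma sum_indicator_cells:
  assumes x: "0 < x" "x \<le> 1"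
  shows "(\<Sum>a. \<Sum>c\<in>{1..<b}. indicator (cell a c) x :: ennreal) = 1"
proof -
  obtain a c where ac: "c \<in> {1..<b}" "x \<in> cell a c" using unit_in_cell[OF x] .
  have "indicator (cell a' c') x = (if a' = a then if c' = c then 1 else 0 else 0 :: ennreal)" if "c' \<in> {1..<b}" for a' c'
    using ac that x by (auto simp: indicator_def mem_cell_iff_digits)
  then have "(\<Sum>a'. \<Sum>c'\<in>{1..<b}. indicator (cell a' c') x :: ennreal) =
      (\<Sum>a'. \<Sum>c'\<in>{1..<b}. if a' = a then if c' = c then 1 else 0 else 0)"
    by (intro suminf_cong sum.cong) auto
  also have "\<dots> = (\<Sum>a'. if a' = a then 1 else 0)"
    using ac by (intro suminf_cong) (auto simp: sum.delta)
  also have "\<dots> = 1" using sums_unique[OF sums_single[of a "\<lambda>_. 1 :: ennreal"]] by simp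
  finally show ?thesis .
qed

text \<open>The point t = 1 is excluded since its image belongs to the neighbouring cell, where the
  map takes the value 0.\<close>

lemma gauss_map_branch:
  assumes c: "c \<in> {1..<b}" and t: "0 \<le> t" "t < 1"
  shows "gauss_map (branch a c t) = t"
proof -
  have p: "real b ^ a > 0" using b_gt0 by simp
  have i: "1 / branch a c t = real b ^ a * (real c + t)" by (simp add: branch_def)
  have "clog_exponent b (1 / branch a c t) = int a" "clog_coeff b (1 / branch a c t) = int c"
    unfolding i using p t by (intro clog_digits_eqI[OF b_ge2 c, of a]; simp add: mult.commute)+
  then show ?thesis
    unfolding gauss_map_def using p by (simp add: i)
qed

lemma gauss_map_measurable [measurable]: "gauss_map \<in> borel_measurable borel"
proof -
  have [measurable]: "(\<lambda>x. clog_exponent b (1 / x)) \<in> borel \<rightarrow>\<^sub>M count_space UNIV"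
    unfolding clog_exponent_def by measurable
  have [measurable]: "(\<lambda>x. real b powi clog_exponent b (1 / x)) \<in> borel_measurable borel"
    by (rule measurable_compose[of _ _ "count_space UNIV"]) measurable
  show ?thesis
    unfolding gauss_map_def clog_coeff_def by measurable
qed

lemma cell_borel [measurable]: "cell a c \<in> sets borel"
  by (simp add: cell_def)

lemma weight_measurable [measurable]: "weight a c \<in> borel_measurable borel"
  unfolding weight_def by measurable

lemma branch_measurable [measurable]: "branch a c \<in> borel_measurable borel"
  unfolding branch_def by measurable

lemma transfer_measurable:
  assumes [measurable]: "f \<in> borel_measurable borel"
  shows "transfer f \<in> borel_measurable borel"
  unfolding transfer_def by measurable

section \<open>The invariant density and the change of variables along branches\<close>

definition dens :: "real \<Rightarrow> real" where
  "dens x = (real b - 1) / ln (2 * real b / (real b + 1)) / ((1 + x) * (real b + x)) * indicator {0..1} x"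

definition gauss_measure :: "real measure" where
  "gauss_measure = density lborel dens"

lemma ln_const_pos: "ln (2 * real b / (real b + 1)) > 0"
  using b_ge2' by (intro ln_gt_zero) (simp add: field_simps)

lemma dens_nonneg: "0 \<le> dens x"
  using b_ge2' ln_const_pos by (auto simp: dens_def indicator_def intro!: mult_nonneg_nonneg divide_nonneg_nonneg)

lemma dens_pos: "x \<in> {0..1} \<Longrightarrow> 0 < dens x"
  using b_ge2' ln_const_pos by (auto simp: dens_def)

lemma dens_measurable [measurable]: "dens \<in> borel_measurable borel"
  unfolding dens_def by measurable

lemma sets_gauss_measure [measurable_cong, simp]: "sets gauss_measure = sets borel"
  by (simp add: gauss_measure_def)

lemma space_gauss_measure [simp]: "space gauss_measure = UNIV"
  by (simp add: gauss_measure_def)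

lemma nn_integral_gauss:
  fixes f :: "real \<Rightarrow> ennreal"
  shows "f \<in> borel_measurable borel \<Longrightarrow> (\<integral>\<^sup>+x. f x \<partial>gauss_measure) = (\<integral>\<^sup>+x. dens x * f x \<partial>lborel)"
  unfolding gauss_measure_def by (subst nn_integral_density) auto

text \<open>The density is positive exactly on [0,1], so both measures have the same null sets
  there. This carries the final result back to Lebesgue measure.\<close>

lemma AE_gauss_iff: "(AE x in gauss_measure. P x) \<longleftrightarrow> (AE x in lborel. x \<in> {0..1} \<longrightarrow> P x)"
proof -
  have "0 < ennreal (dens x) \<longleftrightarrow> x \<in> {0..1}" for x
    by (cases "x \<in> {0..1}") (use dens_pos[of x] in \<open>auto simp: dens_def\<close>)
  then show ?thesis unfolding gauss_measure_def by (subst AE_density) auto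
qed

lemma AE_gauss_unit: "AE x in gauss_measure. x \<in> {0<..<1}"
  unfolding AE_gauss_iff using AE_lborel_singleton[of "0::real"] AE_lborel_singleton[of "1::real"]
  by eventually_elim auto

lemma AE_gaussI:
  assumes "\<And>x. 0 < x \<Longrightarrow> x < 1 \<Longrightarrow> P x"
  shows "AE x in gauss_measure. P x"
  using AE_gauss_unit by eventually_elim (auto intro: assms)

text \<open>The cofactor on the left is the absolute derivative of \<open>branch a c\<close> at t,
  so the identity exhibits \<open>weight\<close> as the Jacobian normalised by the density.\<close>

lemma dens_branch:
  assumes t: "t \<in> {0..1}" and c: "c \<ge> 1"
  shows "dens (branch a c t) * (1 / (real b ^ a * (real c + t)\<^sup>2)) = dens t * weight a c t"
proof -
  define p where "p = real b ^ a"
  define s where "s = real c + t"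
  define B where "B = real b"
  define \<kappa> where "\<kappa> = (B - 1) / ln (2 * B / (B + 1))"
  have pos: "p > 0" "s > 0" "B > 0" "1 + t > 0" "B + t > 0"
    using b_gt0 t c by (auto simp: p_def s_def B_def)
  then have ps: "p * s + 1 > 0" "B * p * s + 1 > 0" by (auto intro!: add_pos_pos)
  have "\<kappa> / ((1 + 1 / (p * s)) * (B + 1 / (p * s))) * (1 / (p * s\<^sup>2)) =
      \<kappa> / ((1 + t) * (B + t)) * (p * (1 + t) * (B + t) / ((p * s + 1) * (B * p * s + 1)))"
  proof -
    have "(1 + 1 / (p * s)) = (p * s + 1) / (p * s)" "(B + 1 / (p * s)) = (B * p * s + 1) / (p * s)"
      using pos by (auto simp: field_simps)
    then show ?thesis using pos ps by (simp add: power2_eq_square)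
  qed
  moreover have "branch a c t \<in> {0..1}" by (rule branch_in_unit[OF t c])
  moreover have "dens (branch a c t) = \<kappa> / ((1 + 1 / (p * s)) * (B + 1 / (p * s)))"
    using \<open>branch a c t \<in> {0..1}\<close> by (simp add: dens_def branch_def \<kappa>_def B_def p_def s_def)
  moreover have "dens t = \<kappa> / ((1 + t) * (B + t))"
    using t by (simp add: dens_def \<kappa>_def B_def)
  moreover have "weight a c t = p * (1 + t) * (B + t) / ((p * s + 1) * (B * p * s + 1))"
    by (simp add: weight_def p_def s_def B_def)
  ultimately show ?thesis by (simp only: p_def[symmetric] s_def[symmetric])
qed

lemma nn_integral_cell:
  fixes F :: "real \<Rightarrow> ennreal"
  assumes [measurable]: "F \<in> borel_measurable borel" and c: "c \<ge> 1"
  shows "(\<integral>\<^sup>+x. F x * indicator (cell a c) x \<partial>gauss_measure) =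
    (\<integral>\<^sup>+t. weight a c t * F (branch a c t) \<partial>gauss_measure)"
proof -
  define p where "p = real b ^ a"
  have p: "p > 0" using b_gt0 by (simp add: p_def)
  \<comment> \<open>The substitution rule wants a nonnegative derivative, but branches decrease; the
    reflection t = 1 - u corrects this and is undone afterwards by an affine substitution.\<close>
  define g where "g u = branch a c (1 - u)" for u
  define g' where "g' u = 1 / (p * (real c + (1 - u))\<^sup>2)" for u
  have g_eq: "g u = 1 / (p * (real c + (1 - u)))" for u by (simp add: g_def branch_def p_def)
  have [measurable]: "g \<in> borel_measurable borel" "g' \<in> borel_measurable borel"
    unfolding g_def g'_def by measurable
  have "(\<integral>\<^sup>+x. F x * indicator (cell a c) x \<partial>gauss_measure) =
      (\<integral>\<^sup>+x. (dens x * F x) * indicator {g 0..g 1} x \<partial>lborel)"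
  proof (subst nn_integral_gauss)
    \<comment> \<open>The half-open cell and the closed interval differ only in the point
      \<open>g 0\<close>, which is null.\<close>
    show "(\<integral>\<^sup>+x. dens x * (F x * indicator (cell a c) x) \<partial>lborel) =
        (\<integral>\<^sup>+x. (dens x * F x) * indicator {g 0..g 1} x \<partial>lborel)"
      using AE_lborel_singleton[of "g 0"]
      by (intro nn_integral_cong_AE, eventually_elim)
         (auto simp: cell_def g_eq p_def indicator_def split: if_splits)
  qed measurable
  also have "\<dots> = (\<integral>\<^sup>+u. (dens (g u) * F (g u)) * g' u * indicator {0..1} u \<partial>lborel)"
  proof (rule nn_integral_substitution_aux)
    fix u :: real assume u: "u \<in> {0..1}"
    then have "real c + (1 - u) > 0" using c by auto
    then show "(g has_real_derivative g' u) (at u)"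
      unfolding g_eq g'_def using p
      by (auto intro!: derivative_eq_intros simp: power2_eq_square)
    show "0 \<le> g' u" using p by (simp add: g'_def)
  next
    show "continuous_on {0..1} g'"
      unfolding g'_def using p c by (intro continuous_intros) auto
  qed auto
  also have "\<dots> = (\<integral>\<^sup>+t. (dens (branch a c t) * F (branch a c t)) * (1 / (p * (real c + t)\<^sup>2)) * indicator {0..1} t \<partial>lborel)"
    by (subst nn_integral_real_affine[where t = 1 and c = "-1"])
       (auto simp: g_def g'_def indicator_def intro!: nn_integral_cong)
  also have "\<dots> = (\<integral>\<^sup>+t. dens t * (weight a c t * F (branch a c t)) \<partial>lborel)"
  proof (rule nn_integral_cong)
    fix t :: real
    show "(dens (branch a c t) * F (branch a c t)) * (1 / (p * (real c + t)\<^sup>2)) * indicator {0..1} t =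
        dens t * (weight a c t * F (branch a c t))"
    proof (cases "t \<in> {0..1}")
      case True
      have "(dens (branch a c t) * F (branch a c t)) * ennreal (1 / (p * (real c + t)\<^sup>2)) =
          ennreal (dens (branch a c t) * (1 / (p * (real c + t)\<^sup>2))) * F (branch a c t)"
        using p by (subst ennreal_mult) (auto simp: dens_nonneg mult_ac)
      also have "dens (branch a c t) * (1 / (p * (real c + t)\<^sup>2)) = dens t * weight a c t"
        using dens_branch[OF True c] by (simp add: p_def)
      also have "ennreal (dens t * weight a c t) = ennreal (dens t) * ennreal (weight a c t)"
        using dens_nonneg weight_nonneg[OF True] by (intro ennreal_mult)
      finally show ?thesis using True by (simp add: mult.assoc)
    next
      case False
      then show ?thesis by (simp add: dens_def)
    qed
  qed
  also have "\<dots> = (\<integral>\<^sup>+t. weight a c t * F (branch a c t) \<partial>gauss_measure)"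
    by (subst nn_integral_gauss) auto
  finally show ?thesis .
qed

text \<open>Duality between the map and its operator: split over cells, substitute on each, and use
  that the map undoes each branch to pull \<open>G\<close> out of the sum. Working in
  \<open>ennreal\<close> makes the exchanges of sum and integral free of integrability
  conditions.\<close>

lemma nn_integral_transfer:
  fixes G :: "real \<Rightarrow> ennreal"
  assumes [measurable]: "f \<in> borel_measurable borel" "G \<in> borel_measurable borel"
    and f: "\<And>y. y \<in> {0..1} \<Longrightarrow> 0 \<le> f y" "\<And>y. y \<in> {0..1} \<Longrightarrow> f y \<le> B"
  shows "(\<integral>\<^sup>+x. f x * G (gauss_map x) \<partial>gauss_measure) = (\<integral>\<^sup>+x. transfer f x * G x \<partial>gauss_measure)"
proof -
  have "(\<integral>\<^sup>+x. f x * G (gauss_map x) \<partial>gauss_measure) =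
      (\<integral>\<^sup>+x. (\<Sum>a. \<Sum>c\<in>{1..<b}. f x * G (gauss_map x) * indicator (cell a c) x) \<partial>gauss_measure)"
    using AE_gauss_unit
  proof (intro nn_integral_cong_AE, eventually_elim)
    case (elim x)
    then show ?case
      using sum_indicator_cells[of x] by (simp add: sum_distrib_left[symmetric])
  qed
  also have "\<dots> = (\<Sum>a. \<Sum>c\<in>{1..<b}. \<integral>\<^sup>+x. f x * G (gauss_map x) * indicator (cell a c) x \<partial>gauss_measure)"
    by (subst nn_integral_suminf, measurable) (intro suminf_cong nn_integral_sum, measurable)
  also have "\<dots> = (\<Sum>a. \<Sum>c\<in>{1..<b}. \<integral>\<^sup>+t. weight a c t * (f (branch a c t) * G (gauss_map (branch a c t))) \<partial>gauss_measure)"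
    by (intro suminf_cong sum.cong refl nn_integral_cell) auto
  also have "\<dots> = (\<integral>\<^sup>+t. (\<Sum>a. \<Sum>c\<in>{1..<b}. weight a c t * (f (branch a c t) * G (gauss_map (branch a c t)))) \<partial>gauss_measure)"
    by (subst nn_integral_suminf, measurable) (intro suminf_cong nn_integral_sum[symmetric], measurable)
  also have "\<dots> = (\<integral>\<^sup>+x. transfer f x * G x \<partial>gauss_measure)"
    using AE_gauss_unit
  proof (intro nn_integral_cong_AE, eventually_elim)
    case (elim t)
    then have t: "t \<in> {0..1}" by auto
    have fb: "0 \<le> f (branch a c t)" if "c \<in> {1..<b}" for a c
      using f branch_in_unit[OF t] that by auto
    have "(\<Sum>a. \<Sum>c\<in>{1..<b}. weight a c t * (f (branch a c t) * G (gauss_map (branch a c t)))) =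
        (\<Sum>a. ennreal (\<Sum>c\<in>{1..<b}. weight a c t * f (branch a c t)) * G t)"
    proof (intro suminf_cong)
      fix a
      have "(\<Sum>c\<in>{1..<b}. weight a c t * (f (branch a c t) * G (gauss_map (branch a c t)))) =
          (\<Sum>c\<in>{1..<b}. ennreal (weight a c t * f (branch a c t)) * G t)"
        using elim t weight_nonneg[OF t] fb by (intro sum.cong) (auto simp: gauss_map_branch ennreal_mult mult.assoc)
      also have "\<dots> = ennreal (\<Sum>c\<in>{1..<b}. weight a c t * f (branch a c t)) * G t"
        using weight_nonneg[OF t] fb by (subst sum_ennreal[symmetric]) (auto simp: sum_distrib_right)
      finally show "(\<Sum>c\<in>{1..<b}. weight a c t * (f (branch a c t) * G (gauss_map (branch a c t)))) =
          ennreal (\<Sum>c\<in>{1..<b}. weight a c t * f (branch a c t)) * G t" .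
    qed
    also have "\<dots> = (\<Sum>a. ennreal (\<Sum>c\<in>{1..<b}. weight a c t * f (branch a c t))) * G t" by simp
    also have "(\<Sum>a. ennreal (\<Sum>c\<in>{1..<b}. weight a c t * f (branch a c t))) = ennreal (transfer f t)"
    proof -
      have "(\<lambda>a. \<Sum>c\<in>{1..<b}. weight a c t * f (branch a c t)) sums transfer f t"
        using f by (intro transfer_sums[OF t, of f B]) auto
      then show ?thesis
        using weight_nonneg[OF t] fb by (subst suminf_ennreal2) (auto intro!: sum_nonneg mult_nonneg_nonneg simp: sums_iff)
    qed
    finally show ?case .
  qed
  finally show ?thesis .
qed

lemma emeasure_gauss_interval:
  assumes uv: "0 \<le> u" "u \<le> v" "v \<le> 1"
  shows "emeasure gauss_measure {u<..v} =
    ennreal ((ln (1 + v) - ln (real b + v) - (ln (1 + u) - ln (real b + u))) / ln (2 * real b / (real b + 1)))"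
proof -
  define Z where "Z = ln (2 * real b / (real b + 1))"
  \<comment> \<open>The antiderivative comes from (b - 1) / ((1 + x) (b + x)) = 1 / (1 + x) - 1 / (b
    + x). Its numerator grows by ln (2 b / (b + 1)) over [0,1], whence the normalising
    constant.\<close>
  define F where "F x = (ln (1 + x) - ln (real b + x)) / Z" for x
  define h where "h x = (real b - 1) / Z / ((1 + x) * (real b + x))" for x
  have Z: "Z > 0" using ln_const_pos by (simp add: Z_def)
  have [measurable]: "h \<in> borel_measurable borel" unfolding h_def by measurable
  have "emeasure gauss_measure {u<..v} = (\<integral>\<^sup>+x. ennreal (dens x) * indicator {u<..v} x \<partial>lborel)"
    unfolding gauss_measure_def by (simp add: emeasure_density)
  also have "\<dots> = (\<integral>\<^sup>+x. ennreal (h x) * indicator {u..v} x \<partial>lborel)"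
    by (intro nn_integral_cong_AE eventually_mono[OF AE_lborel_singleton[of u]])
      (use uv in \<open>auto simp: dens_def h_def Z_def indicator_def\<close>)
  also have "\<dots> = F v - F u"
  proof (rule nn_integral_FTC_Icc)
    fix x assume x: "x \<in> {u..v}"
    then have pos: "1 + x > 0" "real b + x > 0" using uv b_gt0 by auto
    have "(F has_real_derivative (1 / (1 + x) - 1 / (real b + x)) / Z) (at x)"
      unfolding F_def using pos Z by (auto intro!: derivative_eq_intros)
    also have "(1 / (1 + x) - 1 / (real b + x)) / Z = h x"
      using pos Z by (simp add: h_def diff_frac_eq)
    finally show "(F has_real_derivative h x) (at x)" .
    show "0 \<le> h x" using pos Z b_ge2' by (simp add: h_def)
  qed (use uv in auto)
  finally show ?thesis by (simp add: F_def Z_def diff_divide_distrib)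
qed

lemma prob_space_gauss_measure: "prob_space gauss_measure"
proof (rule prob_spaceI)
  have "emeasure gauss_measure UNIV = emeasure gauss_measure {0<..1}"
    by (rule emeasure_eq_AE, rule AE_gaussI) auto
  also have "\<dots> = 1"
    using b_gt0 ln_const_pos by (subst emeasure_gauss_interval) (auto simp: ln_div ln_mult add_ac)
  finally show "emeasure gauss_measure (space gauss_measure) = 1" by simp
qed

interpretation gauss: prob_space gauss_measure
  by (rule prob_space_gauss_measure)

lemma measure_gauss_UNIV [simp]: "measure gauss_measure UNIV = 1"
  using gauss.prob_space by simp

lemma measure_gauss_cell:
  assumes l: "l \<ge> 1"
  shows "measure gauss_measure (cell k l) =
    ln (((1 + inverse (real l) * inverse (real b ^ k)) * (real b + inverse (real l + 1) * inverse (real b ^ k))) /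
        ((real b + inverse (real l) * inverse (real b ^ k)) * (1 + inverse (real l + 1) * inverse (real b ^ k))))
      / ln (2 * real b / (real b + 1))"
proof -
  define u where "u = inverse (real l + 1) * inverse (real b ^ k)"
  define v where "v = inverse (real l) * inverse (real b ^ k)"
  have cell: "cell k l = {u<..v}"
    unfolding cell_def u_def v_def by (simp add: divide_inverse mult.commute)
  have uv: "0 \<le> u" "u \<le> v" using l by (auto simp: u_def v_def intro!: mult_right_mono)
  have "v \<le> 1" using l bpow_ge1[of k] unfolding v_def by (intro mult_le_one) (auto simp: inverse_le_1_iff)
  have "measure gauss_measure (cell k l) =
      (ln (1 + v) - ln (real b + v) - (ln (1 + u) - ln (real b + u))) / ln (2 * real b / (real b + 1))"
  proof -
    \<comment> \<open>The sign matters because \<open>ennreal\<close> cuts negative numbers off to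
      0; it follows since (1 + x) / (b + x) is increasing.\<close>
    have "0 \<le> ln (1 + v) - ln (real b + v) - (ln (1 + u) - ln (real b + u))"
    proof -
      have "(1 + u) * (real b + v) \<le> (1 + v) * (real b + u)"
        using mult_nonneg_nonneg[of "real b - 1" "v - u"] uv b_ge2' by (simp add: algebra_simps)
      then have "ln ((1 + u) * (real b + v)) \<le> ln ((1 + v) * (real b + u))"
        using uv b_gt0 by (intro ln_mono mult_pos_pos) auto
      then show ?thesis using uv b_gt0 by (simp add: ln_mult)
    qed
    then show ?thesis
      unfolding cell measure_def emeasure_gauss_interval[OF uv \<open>v \<le> 1\<close>]
      using ln_const_pos by simp
  qed
  also have "ln (1 + v) - ln (real b + v) - (ln (1 + u) - ln (real b + u)) =
      ln (((1 + v) * (real b + u)) / ((real b + v) * (1 + u)))"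
    using uv b_gt0 by (simp add: ln_div ln_mult)
  finally show ?thesis by (simp add: u_def v_def)
qed

section \<open>Invariance of the measure and its consequences for orbits\<close>

lemma transfer_const_1: "x \<in> {0..1} \<Longrightarrow> transfer (\<lambda>_. 1) x = 1"
  using weight_sums[of x] by (simp add: transfer_def sums_iff)

lemma gauss_map_funpow_measurable [measurable]: "(gauss_map ^^ n) \<in> borel_measurable borel"
proof (induction n)
  case (Suc n)
  note [measurable] = Suc
  show ?case unfolding funpow.simps comp_def by measurable
qed (simp add: id_def)

text \<open>Duality applied to the constant function 1, which the operator fixes.\<close>

lemma distr_gauss_map: "distr gauss_measure borel gauss_map = gauss_measure"
proof (rule measure_eqI)
  fix B assume "B \<in> sets (distr gauss_measure borel gauss_map)"
  then have [measurable]: "B \<in> sets borel" by simp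
  have "emeasure (distr gauss_measure borel gauss_map) B = emeasure gauss_measure (gauss_map -` B)"
    by (simp add: emeasure_distr)
  also have "\<dots> = (\<integral>\<^sup>+x. indicator (gauss_map -` B) x \<partial>gauss_measure)"
    using measurable_sets_borel[OF gauss_map_measurable, of B] by (simp add: nn_integral_indicator)
  also have "\<dots> = (\<integral>\<^sup>+x. ennreal 1 * indicator B (gauss_map x) \<partial>gauss_measure)"
    by (intro nn_integral_cong) (simp add: indicator_def)
  also have "\<dots> = (\<integral>\<^sup>+x. ennreal (transfer (\<lambda>_. 1) x) * indicator B x \<partial>gauss_measure)"
    by (rule nn_integral_transfer[of "\<lambda>_. 1" _ 1]) auto
  also have "\<dots> = (\<integral>\<^sup>+x. indicator B x \<partial>gauss_measure)"
    by (intro nn_integral_cong_AE AE_gaussI) (simp add: transfer_const_1)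
  finally show "emeasure (distr gauss_measure borel gauss_map) B = emeasure gauss_measure B"
    by (simp add: nn_integral_indicator)
qed simp

lemma distr_gauss_map_funpow: "distr gauss_measure borel (gauss_map ^^ n) = gauss_measure"
proof (induction n)
  case 0
  show ?case by (simp add: id_def distr_id2)
next
  case (Suc n)
  have "distr gauss_measure borel (gauss_map ^^ Suc n) = distr (distr gauss_measure borel (gauss_map ^^ n)) borel gauss_map"
    by (subst distr_distr) (auto simp: comp_def)
  also have "\<dots> = gauss_measure" unfolding Suc distr_gauss_map ..
  finally show ?case .
qed

lemma measure_gauss_vimage_funpow:
  assumes [measurable]: "B \<in> sets borel"
  shows "measure gauss_measure ((gauss_map ^^ n) -` B) = measure gauss_measure B"
proof -
  have "measure gauss_measure ((gauss_map ^^ n) -` B) = measure (distr gauss_measure borel (gauss_map ^^ n)) B"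
    by (simp add: measure_distr)
  then show ?thesis by (simp add: distr_gauss_map_funpow)
qed

text \<open>Invariance pulls the full-measure set (0,1) back along every iterate, and there are
  countably many. Such orbits never reach 0, so the process does not stop; no discussion of
  irrationality is involved.\<close>

lemma AE_gauss_orbit_in_unit: "AE x in gauss_measure. \<forall>n. (gauss_map ^^ n) x \<in> {0<..<1}"
  unfolding AE_all_countable
proof
  fix n
  show "AE x in gauss_measure. (gauss_map ^^ n) x \<in> {0<..<1}"
    by (rule AE_distrD[of "gauss_map ^^ n" _ borel])
      (simp, simp only: distr_gauss_map_funpow AE_gauss_unit)
qed

section \<open>Means of functions in the cone\<close>

abbreviation mean :: "(real \<Rightarrow> real) \<Rightarrow> real" where
  "mean f \<equiv> integral\<^sup>L gauss_measure f"

lemma integrable_cone: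
  assumes [measurable]: "f \<in> borel_measurable borel" and f: "f \<in> distortion_cone K"
  shows "integrable gauss_measure f"
proof -
  obtain B where B: "\<And>y. y \<in> {0..1} \<Longrightarrow> \<bar>f y\<bar> \<le> B" using cone_bounded[OF f] by blast
  show ?thesis
    by (rule gauss.integrable_const_bound[where B = B, OF AE_gaussI]) (use B in auto)
qed

lemma AE_gauss_cone_nonneg: "f \<in> distortion_cone K \<Longrightarrow> AE x in gauss_measure. 0 \<le> f x"
  using AE_gauss_unit by eventually_elim (auto intro: coneD(1))

text \<open>Integrating \<open>cone_le_pow2\<close> in one variable against a probability measure,
  with the other variable fixed, compares each value with the mean.\<close>

lemma mean_cone_bounds:
  assumes [measurable]: "f \<in> borel_measurable borel" and f: "f \<in> distortion_cone (real k)" and x: "x \<in> {0..1}"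
  shows "mean f \<le> 2 ^ k * f x" "f x \<le> 2 ^ k * mean f" "0 \<le> mean f"
proof -
  have i: "integrable gauss_measure f" by (rule integrable_cone[OF _ f]) simp
  have "mean f \<le> mean (\<lambda>_. 2 ^ k * f x)"
    by (intro integral_mono_AE i AE_gaussI cone_le_pow2[OF f _ x]) auto
  then show "mean f \<le> 2 ^ k * f x" by simp
  have "mean (\<lambda>_. f x) \<le> mean (\<lambda>y. 2 ^ k * f y)"
    using i by (intro integral_mono_AE AE_gaussI cone_le_pow2[OF f x]) auto
  then show "f x \<le> 2 ^ k * mean f" by simp
  show "0 \<le> mean f" by (rule integral_nonneg_AE[OF AE_gauss_cone_nonneg[OF f]])
qed

lemma transfer_cone16: "f \<in> distortion_cone 16 \<Longrightarrow> transfer f \<in> distortion_cone 12"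
  using transfer_cone[of f 16] by simp

lemma mean_transfer:
  assumes [measurable]: "f \<in> borel_measurable borel" and f: "f \<in> distortion_cone 16"
  shows "mean (transfer f) = mean f"
proof -
  note [measurable] = transfer_measurable
  obtain B where B: "\<And>y. y \<in> {0..1} \<Longrightarrow> \<bar>f y\<bar> \<le> B" using cone_bounded[OF f] by blast
  have "(\<integral>\<^sup>+x. ennreal (f x) * 1 \<partial>gauss_measure) = (\<integral>\<^sup>+x. ennreal (transfer f x) * 1 \<partial>gauss_measure)"
    by (rule nn_integral_transfer[where B = B and G = "\<lambda>_. 1"]) (use B coneD(1)[OF f] in \<open>auto simp: abs_le_iff\<close>)
  then have "ennreal (mean f) = ennreal (mean (transfer f))"
    using nn_integral_eq_integral[OF integrable_cone[OF assms] AE_gauss_cone_nonneg[OF f]]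
      nn_integral_eq_integral[OF integrable_cone[OF transfer_measurable transfer_cone16[OF f]]
        AE_gauss_cone_nonneg[OF transfer_cone16[OF f]]] by simp
  then show ?thesis
    using integral_nonneg_AE[OF AE_gauss_cone_nonneg[OF f]]
      integral_nonneg_AE[OF AE_gauss_cone_nonneg[OF transfer_cone16[OF f]]] by simp
qed

section \<open>Exponential mixing\<close>

lemma transfer_funpow:
  assumes "f \<in> borel_measurable borel" "f \<in> distortion_cone 16"
  shows "(transfer ^^ n) f \<in> borel_measurable borel \<and> (transfer ^^ n) f \<in> distortion_cone 16 \<and> mean ((transfer ^^ n) f) = mean f"
proof (induction n)
  case (Suc n)
  then show ?case
    using transfer_measurable cone_mono[OF _ transfer_cone16, of 16] mean_transfer by auto
qed (use assms in auto)

lemma cone_cong: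
  assumes "\<And>x. x \<in> {0..1} \<Longrightarrow> f x = g x" "f \<in> distortion_cone K"
  shows "g \<in> distortion_cone K"
  using assms unfolding distortion_cone_def by simp

lemma transfer_funpow_minus_const:
  fixes q :: real and n :: nat
  assumes f: "f \<in> borel_measurable borel" "f \<in> distortion_cone 16"
  defines "g \<equiv> \<lambda>x. (transfer ^^ n) f x - mean f * (1 - q ^ n)"
  shows "g \<in> borel_measurable borel" "mean g = mean f * q ^ n"
proof -
  define h where "h = (transfer ^^ n) f"
  have h [measurable]: "h \<in> borel_measurable borel" and hc: "h \<in> distortion_cone 16" and mh: "mean h = mean f"
    using transfer_funpow[OF f, of n] by (auto simp: h_def)
  have g: "g = (\<lambda>x. h x - mean f * (1 - q ^ n))" by (simp add: g_def h_def)
  show "g \<in> borel_measurable borel" unfolding g by measurable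
  have "mean g = mean h - mean (\<lambda>_. mean f * (1 - q ^ n))"
    unfolding g by (rule Bochner_Integration.integral_diff[OF integrable_cone[OF h hc]]) simp
  then show "mean g = mean f * q ^ n" by (simp add: mh algebra_simps)
qed

text \<open>
  On the cone of distortion \<open>12\<close> the mean is at most \<open>2\<^sup>1\<^sup>2\<close> times the minimum, and a quarter of the
  minimum may be subtracted without leaving the cone of distortion \<open>16\<close>: this gives \<open>2\<^sup>1\<^sup>4\<close>.
\<close>

lemma transfer_funpow_minus_const_cone:
  assumes f: "f \<in> borel_measurable borel" "f \<in> distortion_cone 16"
  shows "(\<lambda>x. (transfer ^^ n) f x - mean f * (1 - (1 - 1 / 2 ^ 14) ^ n)) \<in> distortion_cone 16"
proof (induction n)
  case 0
  show ?case using f by simp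
next
  case (Suc n)
  define q :: real where "q = 1 - 1 / 2 ^ 14"
  define t where "t = mean f * (1 - q ^ n)"
  define h where "h = (transfer ^^ n) f"
  define g where "g x = h x - t" for x
  have gm: "g \<in> borel_measurable borel" and mg: "mean g = mean f * q ^ n"
    using transfer_funpow_minus_const[OF f, of n q] unfolding g_def h_def t_def .
  have hc: "h \<in> distortion_cone 16" using transfer_funpow[OF f, of n] by (simp add: h_def)
  have g: "g \<in> distortion_cone 16" using Suc.IH unfolding g_def h_def t_def q_def .
  obtain B where B: "\<And>y. y \<in> {0..1} \<Longrightarrow> \<bar>h y\<bar> \<le> B"
    using cone_bounded[OF hc] by blast
  have tg: "transfer g x = (transfer ^^ Suc n) f x - t" if "x \<in> {0..1}" for x
    using transfer_diff_const[OF that B] unfolding g_def by (simp add: h_def)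
  have "(\<lambda>x. transfer g x - mean g / 2 ^ 14) \<in> distortion_cone 16"
  proof (rule cone_12_minus_const[OF transfer_cone16[OF g]])
    show "0 \<le> mean g / 2 ^ 14" using mean_cone_bounds(3)[OF gm, of 16 0] g by simp
    fix x :: real assume "x \<in> {0..1}"
    then have "mean (transfer g) \<le> 2 ^ 12 * transfer g x"
      using mean_cone_bounds(1)[OF transfer_measurable[OF gm], of 12 x] transfer_cone16[OF g] by simp
    then show "4 * (mean g / 2 ^ 14) \<le> transfer g x"
      by (simp add: mean_transfer[OF gm g])
  qed
  then show ?case
  proof (rule cone_cong[rotated])
    fix x :: real assume x: "x \<in> {0..1}"
    \<comment> \<open>As 1 - q = 1 / 2^14, the constant removed so far, t, and the new one,
      \<open>mean f\<close> q^n (1 - q), add up to \<open>mean f\<close> (1 - q^(n+1)).\<close>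
    show "transfer g x - mean g / 2 ^ 14 = (transfer ^^ Suc n) f x - mean f * (1 - (1 - 1 / 2 ^ 14) ^ Suc n)"
      unfolding tg[OF x] mg t_def q_def[symmetric] by (simp add: q_def algebra_simps)
  qed
qed

text \<open>The remainder \<open>g\<close> stays in the cone of distortion 16 and its mean is y =
  \<open>mean f\<close> q^n. So \<open>g x\<close> and y both lie between 0 and 2^16 y, and the
  deviation to be bounded is their difference.\<close>

lemma transfer_funpow_converges:
  assumes f: "f \<in> borel_measurable borel" "f \<in> distortion_cone 16" and x: "x \<in> {0..1}"
  shows "\<bar>(transfer ^^ n) f x - mean f\<bar> \<le> 2 ^ 16 * mean f * (1 - 1 / 2 ^ 14) ^ n"
proof -
  define q :: real where "q = 1 - 1 / 2 ^ 14"
  define g where "g x = (transfer ^^ n) f x - mean f * (1 - q ^ n)" for x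
  define y where "y = mean f * q ^ n"
  have gm: "g \<in> borel_measurable borel" and mg: "mean g = y"
    using transfer_funpow_minus_const[OF f, of n q] unfolding g_def y_def .
  have g: "g \<in> distortion_cone 16"
    using transfer_funpow_minus_const_cone[OF f, of n] unfolding g_def q_def .
  have "0 \<le> g x" by (rule coneD(1)[OF g x])
  moreover have "g x \<le> 2 ^ 16 * y" "0 \<le> y"
    using mean_cone_bounds(2,3)[OF gm, of 16 x] g x mg by auto
  moreover have "(transfer ^^ n) f x - mean f = g x - y"
    by (simp add: g_def y_def algebra_simps)
  ultimately have "\<bar>(transfer ^^ n) f x - mean f\<bar> \<le> 2 ^ 16 * y"
    by (simp add: abs_le_iff)
  then show ?thesis by (simp add: q_def y_def)
qed

lemma nn_integral_transfer_funpow: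
  assumes "f \<in> borel_measurable borel" "f \<in> distortion_cone 16" and [measurable]: "B \<in> sets borel"
  shows "(\<integral>\<^sup>+x. ennreal (f x) * indicator B ((gauss_map ^^ n) x) \<partial>gauss_measure) =
    (\<integral>\<^sup>+x. ennreal ((transfer ^^ n) f x) * indicator B x \<partial>gauss_measure)"
  using assms(1,2)
proof (induction n arbitrary: f)
  case (Suc n)
  note [measurable] = Suc.prems(1)
  obtain B' where B': "\<And>y. y \<in> {0..1} \<Longrightarrow> \<bar>f y\<bar> \<le> B'" using cone_bounded[OF Suc.prems(2)] by blast
  have "(\<integral>\<^sup>+x. ennreal (f x) * indicator B ((gauss_map ^^ Suc n) x) \<partial>gauss_measure) =
      (\<integral>\<^sup>+x. ennreal (f x) * indicator B ((gauss_map ^^ n) (gauss_map x)) \<partial>gauss_measure)"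
    by (simp only: funpow_Suc_right comp_apply)
  also have "\<dots> = (\<integral>\<^sup>+x. ennreal (transfer f x) * indicator B ((gauss_map ^^ n) x) \<partial>gauss_measure)"
    by (rule nn_integral_transfer[where B = B' and G = "\<lambda>x. indicator B ((gauss_map ^^ n) x)"])
       (use B' coneD(1)[OF Suc.prems(2)] in \<open>auto simp: abs_le_iff\<close>)
  also have "\<dots> = (\<integral>\<^sup>+x. ennreal ((transfer ^^ n) (transfer f) x) * indicator B x \<partial>gauss_measure)"
    using transfer_measurable[OF Suc.prems(1)] cone_mono[OF _ transfer_cone16[OF Suc.prems(2)], of 16]
    by (intro Suc.IH) auto
  finally show ?case by (simp only: funpow_Suc_right comp_apply)
qed simp

lemma mean_weight:
  assumes "c \<ge> 1"
  shows "mean (weight a c) = measure gauss_measure (cell a c)"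
proof -
  have "emeasure gauss_measure (cell a c) = (\<integral>\<^sup>+x. 1 * indicator (cell a c) x \<partial>gauss_measure)"
    by (simp add: nn_integral_indicator)
  also have "\<dots> = (\<integral>\<^sup>+t. ennreal (weight a c t) * 1 \<partial>gauss_measure)"
    by (rule nn_integral_cell) (use assms in auto)
  also have "\<dots> = ennreal (mean (weight a c))"
    using integrable_cone[OF _ weight_cone] AE_gauss_cone_nonneg[OF weight_cone] assms
    by (simp add: nn_integral_eq_integral)
  finally show ?thesis
    using integral_nonneg_AE[OF AE_gauss_cone_nonneg[OF weight_cone]] assms by (simp add: measure_def)
qed

text \<open>The first step of the map is spent on replacing the indicator of the cell by its weight,
  whose mean is the measure of the cell. Only the remaining n steps contribute to the decay, hence
  \<open>Suc n\<close> on the left and n in the exponent.\<close>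

lemma cell_mixing:
  assumes c: "c \<in> {1..<b}" and [measurable]: "B \<in> sets borel"
  shows "\<bar>measure gauss_measure (cell a c \<inter> (gauss_map ^^ Suc n) -` B) -
      measure gauss_measure (cell a c) * measure gauss_measure B\<bar> \<le> 2 ^ 16 * (1 - 1 / 2 ^ 14) ^ n"
proof -
  define q :: real where "q = 1 - 1 / 2 ^ 14"
  define L where "L = (transfer ^^ n) (weight a c)"
  define p where "p = measure gauss_measure (cell a c)"
  have p: "0 \<le> p" "p \<le> 1" by (auto simp: p_def)
  have w: "weight a c \<in> borel_measurable borel" "weight a c \<in> distortion_cone 16"
    using weight_cone c by auto
  have Lm [measurable]: "L \<in> borel_measurable borel" and Lc: "L \<in> distortion_cone 16"
    using transfer_funpow[OF w] by (auto simp: L_def)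
  have close: "\<bar>L x - p\<bar> \<le> 2 ^ 16 * q ^ n" if "x \<in> {0..1}" for x
  proof -
    have "\<bar>L x - p\<bar> \<le> 2 ^ 16 * p * q ^ n"
      using transfer_funpow_converges[OF w that, of n] mean_weight[of c a] c by (simp add: L_def p_def q_def)
    also have "\<dots> \<le> 2 ^ 16 * 1 * q ^ n"
      using p by (intro mult_right_mono mult_left_mono) (auto simp: q_def)
    finally show ?thesis by simp
  qed
  have Li: "integrable gauss_measure (\<lambda>x. L x * indicator B x)"
    by (rule integrable_real_mult_indicator[OF _ integrable_cone[OF Lm Lc]]) simp
  have Bi: "integrable gauss_measure (\<lambda>x. p * indicator B x)"
    by (intro integrable_mult_right integrable_real_indicator) (auto simp: gauss.emeasure_eq_measure)
  have "emeasure gauss_measure (cell a c \<inter> (gauss_map ^^ Suc n) -` B) =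
      (\<integral>\<^sup>+x. indicator B ((gauss_map ^^ Suc n) x) * indicator (cell a c) x \<partial>gauss_measure)"
  proof -
    have "cell a c \<inter> (gauss_map ^^ Suc n) -` B \<in> sets gauss_measure"
      using measurable_sets_borel[OF gauss_map_funpow_measurable, of B "Suc n"] by simp
    then have "emeasure gauss_measure (cell a c \<inter> (gauss_map ^^ Suc n) -` B) =
        (\<integral>\<^sup>+x. indicator (cell a c \<inter> (gauss_map ^^ Suc n) -` B) x \<partial>gauss_measure)"
      by (simp only: nn_integral_indicator)
    also have "\<dots> = (\<integral>\<^sup>+x. indicator B ((gauss_map ^^ Suc n) x) * indicator (cell a c) x \<partial>gauss_measure)"
      by (intro nn_integral_cong) (auto simp: indicator_def)
    finally show ?thesis .
  qed
  also have "\<dots> = (\<integral>\<^sup>+t. ennreal (weight a c t) * indicator B ((gauss_map ^^ Suc n) (branch a c t)) \<partial>gauss_measure)"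
    by (rule nn_integral_cell) (use c in auto)
  also have "\<dots> = (\<integral>\<^sup>+t. ennreal (weight a c t) * indicator B ((gauss_map ^^ n) t) \<partial>gauss_measure)"
    by (intro nn_integral_cong_AE AE_gaussI) (use c in \<open>simp add: funpow_Suc_right gauss_map_branch del: funpow.simps\<close>)
  also have "\<dots> = (\<integral>\<^sup>+x. ennreal (L x) * indicator B x \<partial>gauss_measure)"
    unfolding L_def by (rule nn_integral_transfer_funpow[OF w]) simp
  also have "\<dots> = (\<integral>\<^sup>+x. ennreal (L x * indicator B x) \<partial>gauss_measure)"
    by (intro nn_integral_cong) (simp add: indicator_def)
  also have "\<dots> = ennreal (mean (\<lambda>x. L x * indicator B x))"
    using AE_gauss_cone_nonneg[OF Lc] by (intro nn_integral_eq_integral Li) (auto elim!: eventually_mono)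
  finally have *: "emeasure gauss_measure (cell a c \<inter> (gauss_map ^^ Suc n) -` B) =
      ennreal (mean (\<lambda>x. L x * indicator B x))" .
  have L_nonneg: "0 \<le> mean (\<lambda>x. L x * indicator B x)"
    using AE_gauss_cone_nonneg[OF Lc] by (intro integral_nonneg_AE) (auto elim!: eventually_mono)
  with * have "measure gauss_measure (cell a c \<inter> (gauss_map ^^ Suc n) -` B) = mean (\<lambda>x. L x * indicator B x)"
    by (simp add: measure_def del: funpow.simps)
  moreover have "p * measure gauss_measure B = mean (\<lambda>x. p * indicator B x)" by simp
  moreover have "mean (\<lambda>x. L x * indicator B x - p * indicator B x) =
      mean (\<lambda>x. L x * indicator B x) - mean (\<lambda>x. p * indicator B x)"
    by (rule Bochner_Integration.integral_diff[OF Li Bi])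
  ultimately have "measure gauss_measure (cell a c \<inter> (gauss_map ^^ Suc n) -` B) - p * measure gauss_measure B
      = mean (\<lambda>x. L x * indicator B x - p * indicator B x)"
    by (simp only:)
  also have "\<bar>\<dots>\<bar> \<le> mean (\<lambda>x. 2 ^ 16 * q ^ n)"
  proof (rule order_trans[OF integral_abs_bound], rule integral_mono_AE)
    show "AE x in gauss_measure. \<bar>L x * indicator B x - p * indicator B x\<bar> \<le> 2 ^ 16 * q ^ n"
      using AE_gauss_unit
    proof eventually_elim
      case (elim x)
      then have "\<bar>L x - p\<bar> \<le> 2 ^ 16 * q ^ n" by (intro close) auto
      then show ?case by (auto simp: indicator_def)
    qed
  qed (use Li Bi in auto)
  finally show ?thesis by (simp add: p_def q_def)
qed

lemma AE_gauss_cell_frequency: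
  assumes c: "c \<in> {1..<b}"
  shows "AE x in gauss_measure. (\<lambda>N. (\<Sum>i<N. indicator ((gauss_map ^^ i) -` cell a c) x) / real N)
    \<longlonglongrightarrow> measure gauss_measure (cell a c)"
proof (rule gauss.strong_law_of_mixing_events)
  define q :: real where "q = 1 - 1 / 2 ^ 14"
  define A where "A = cell a c"
  have [measurable]: "A \<in> sets borel" by (simp add: A_def)
  show "(gauss_map ^^ i) -` cell a c \<in> gauss.events" for i
    using measurable_sets_borel[OF gauss_map_funpow_measurable, of "cell a c" i] by simp
  show "measure gauss_measure ((gauss_map ^^ i) -` cell a c) = measure gauss_measure (cell a c)" for i
    by (rule measure_gauss_vimage_funpow) simp
  show "0 \<le> q" "q < 1" by (auto simp: q_def)
  fix i d
  have "(gauss_map ^^ i) -` A \<inter> (gauss_map ^^ (i + d)) -` A = (gauss_map ^^ i) -` (A \<inter> (gauss_map ^^ d) -` A)"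
    by (auto simp: funpow_add add.commute[of i])
  \<comment> \<open>By invariance the correlation depends on the lag d alone.\<close>
  then have inv: "measure gauss_measure ((gauss_map ^^ i) -` A \<inter> (gauss_map ^^ (i + d)) -` A) =
      measure gauss_measure (A \<inter> (gauss_map ^^ d) -` A)"
    using measurable_sets_borel[OF gauss_map_funpow_measurable, of A d] by (simp only: measure_gauss_vimage_funpow sets.Int \<open>A \<in> sets borel\<close>)
  \<comment> \<open>The factor 1 / q absorbs the shift between d = n + 1 and the exponent n. Lag 0
    is outside the reach of \<open>cell_mixing\<close> and is settled by the trivial bound
    1.\<close>
  have "\<bar>measure gauss_measure (A \<inter> (gauss_map ^^ d) -` A) - (measure gauss_measure A)\<^sup>2\<bar> \<le> 2 ^ 16 / q * q ^ d"
  proof (cases d)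
    case 0
    define p where "p = measure gauss_measure A"
    have "p \<in> {0..1}" by (simp add: p_def)
    then have "0 \<le> p * (1 - p)" "p * (1 - p) \<le> 1"
      using mult_mono[of p 1 "1 - p" 1] by auto
    then have "\<bar>p - p\<^sup>2\<bar> \<le> 1" by (simp add: power2_eq_square algebra_simps)
    then show ?thesis using 0 by (simp add: p_def q_def)
  next
    case (Suc n)
    then show ?thesis
      using cell_mixing[OF c, of A a n] by (simp add: A_def q_def power2_eq_square)
  qed
  then show "\<bar>measure gauss_measure ((gauss_map ^^ i) -` cell a c \<inter> (gauss_map ^^ (i + d)) -` cell a c) -
      (measure gauss_measure (cell a c))\<^sup>2\<bar> \<le> 2 ^ 16 / q * q ^ d"
    using inv by (simp add: A_def)
qed

section \<open>Frequencies of the continued logarithm terms\<close>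

text \<open>For x in (0,1) the start 1 + x has exponent 0 and coefficient 1, so the next term is 1 /
  x. From then on reciprocals follow \<open>gauss_map\<close>, and positivity of its next value says
  that the process does not stop.\<close>

lemma clog_y_orbit:
  assumes x: "\<And>n. (gauss_map ^^ n) x \<in> {0<..<1}"
  shows "clog_y b (1 + x) (Suc n) = Some (1 / (gauss_map ^^ n) x)"
proof (induction n)
  case 0
  have "x \<in> {0<..<1}" using x[of 0] by simp
  then have "clog_exponent b (1 + x) = int 0" "clog_coeff b (1 + x) = int 1"
    using b_ge2 by (intro clog_digits_eqI[OF b_ge2, where c = 1 and a = 0]; simp)+
  then show ?case using \<open>x \<in> {0<..<1}\<close> by simp
next
  case (Suc n)
  define z where "z = (gauss_map ^^ n) x"
  define p where "p = real b powi clog_exponent b (1 / z)"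
  define c where "c = real_of_int (clog_coeff b (1 / z))"
  have p: "p > 0" using b_gt0 by (simp add: p_def)
  have gz: "gauss_map z = 1 / z / p - c" by (simp add: gauss_map_def p_def c_def)
  moreover have "gauss_map z > 0" using x[of "Suc n"] by (simp add: z_def)
  ultimately have "1 / z / p \<noteq> c" by linarith
  then have ne: "1 / z \<noteq> c * p" using p by (auto simp only: nonzero_mult_div_cancel_right)
  have "p / (1 / z - c * p) = 1 / ((1 / z - c * p) / p)" by simp
  also have "(1 / z - c * p) / p = gauss_map z" using p by (simp add: gz diff_divide_distrib)
  finally show ?case
    using ne Suc.IH unfolding clog_y.simps(2)[of _ _ "Suc n"] z_def[symmetric]
    by (simp add: Let_def p_def[symmetric] c_def[symmetric] z_def[symmetric])
qed

lemma clog_freq_orbit: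
  assumes x: "\<And>n. (gauss_map ^^ n) x \<in> {0<..<1}" and l: "l \<in> {1..<b}"
  shows "clog_freq b (1 + x) k l N = (\<Sum>i<N. indicator ((gauss_map ^^ i) -` cell k l) x) / real N"
proof -
  \<comment> \<open>Position 0 is not counted and position i + 1 carries the i-th orbit point, hence
    the shift by \<open>Suc\<close>.\<close>
  have "{n. 1 \<le> n \<and> n \<le> N \<and> clog_digit b (1 + x) n = Some (int k, int l)} =
      Suc ` {i \<in> {..<N}. (gauss_map ^^ i) x \<in> cell k l}"
  proof -
    have "clog_digit b (1 + x) (Suc i) = Some (int k, int l) \<longleftrightarrow> (gauss_map ^^ i) x \<in> cell k l" for i
      using mem_cell_iff_digits[OF l, of "(gauss_map ^^ i) x" k] x[of i]
      by (simp add: clog_digit_def clog_y_orbit[OF x] del: clog_y.simps)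
    then show ?thesis
      by (auto simp: image_iff Suc_le_eq gr0_conv_Suc)
  qed
  then have "real (card {n. 1 \<le> n \<and> n \<le> N \<and> clog_digit b (1 + x) n = Some (int k, int l)}) =
      real (card {i \<in> {..<N}. (gauss_map ^^ i) x \<in> cell k l})"
    by (simp add: card_image)
  also have "\<dots> = (\<Sum>i<N. indicator ((gauss_map ^^ i) -` cell k l) x)"
    by (simp add: indicator_def sum.If_cases Int_def)
  finally show ?thesis by (simp only: clog_freq_def)
qed

lemma AE_gauss_clog:
  "AE x in gauss_measure. clog_infinite b (1 + x) \<and>
     (\<forall>k. \<forall>l\<in>{1..<b}. clog_freq b (1 + x) k l \<longlonglongrightarrow> measure gauss_measure (cell k l))"
proof -
  have "AE x in gauss_measure. \<forall>k. \<forall>l\<in>{1..<b}.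
      (\<lambda>N. (\<Sum>i<N. indicator ((gauss_map ^^ i) -` cell k l) x) / real N) \<longlonglongrightarrow> measure gauss_measure (cell k l)"
    unfolding AE_all_countable
    by (intro allI AE_ball_countable' AE_gauss_cell_frequency) auto
  with AE_gauss_orbit_in_unit show ?thesis
  proof eventually_elim
    case (elim x)
    then have x: "\<And>n. (gauss_map ^^ n) x \<in> {0<..<1}" by blast
    have "clog_y b (1 + x) n \<noteq> None" for n
      using clog_y_orbit[OF x] by (cases n) auto
    moreover have "clog_freq b (1 + x) k l = (\<lambda>N. (\<Sum>i<N. indicator ((gauss_map ^^ i) -` cell k l) x) / real N)"
      if "l \<in> {1..<b}" for k l
      using clog_freq_orbit[OF x that] by (intro ext)
    ultimately show ?case using elim(2) by (simp add: clog_infinite_def)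
  qed
qed

end

theorem theorem22:
  fixes b :: nat
  assumes "b \<ge> 2"
  shows "AE \<alpha> \<in> {1<..<2} in lebesgue.
           clog_infinite b \<alpha> \<and>
           (\<forall>k. \<forall>l\<in>{1..b - 1}.
              convergent (clog_freq b \<alpha> k l) \<and>
              clog_P b \<alpha> k l =
                ln (((1 + inverse (real l) * inverse (real b ^ k)) *
                     (real b + inverse (real l + 1) * inverse (real b ^ k))) /
                    ((real b + inverse (real l) * inverse (real b ^ k)) *
                     (1 + inverse (real l + 1) * inverse (real b ^ k))))
                / ln (2 * real b / (real b + 1)))"
proof -
  interpret clog_base b using assms by unfold_locales
  have "AE x in lborel. x \<in> {0..1} \<longrightarrow> clog_infinite b (1 + x) \<and>
      (\<forall>k. \<forall>l\<in>{1..<b}. clog_freq b (1 + x) k l \<longlonglongrightarrow> measure gauss_measure (cell k l))"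
    using AE_gauss_clog unfolding AE_gauss_iff .
  \<comment> \<open>Translation invariance of Lebesgue measure turns x into \<alpha> - 1.\<close>
  then have "AE x in distr lborel borel ((+) (-1)). x \<in> {0..1} \<longrightarrow> clog_infinite b (1 + x) \<and>
      (\<forall>k. \<forall>l\<in>{1..<b}. clog_freq b (1 + x) k l \<longlonglongrightarrow> measure gauss_measure (cell k l))"
    by (subst lborel_distr_plus)
  then have "AE \<alpha> in lborel. -1 + \<alpha> \<in> {0..1} \<longrightarrow> clog_infinite b (1 + (-1 + \<alpha>)) \<and>
      (\<forall>k. \<forall>l\<in>{1..<b}. clog_freq b (1 + (-1 + \<alpha>)) k l \<longlonglongrightarrow> measure gauss_measure (cell k l))"
    by (rule AE_distrD[rotated]) simp
  then have "AE \<alpha> in lebesgue. -1 + \<alpha> \<in> {0..1} \<longrightarrow> clog_infinite b (1 + (-1 + \<alpha>)) \<and>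
      (\<forall>k. \<forall>l\<in>{1..<b}. clog_freq b (1 + (-1 + \<alpha>)) k l \<longlonglongrightarrow> measure gauss_measure (cell k l))"
    by (rule AE_completion)
  then show ?thesis
  proof eventually_elim
    case (elim \<alpha>)
    show ?case
    proof
      assume "\<alpha> \<in> {1<..<2}"
      then have *: "clog_infinite b \<alpha>"
          "\<And>k l. l \<in> {1..<b} \<Longrightarrow> clog_freq b \<alpha> k l \<longlonglongrightarrow> measure gauss_measure (cell k l)"
        using elim by auto
      have "convergent (clog_freq b \<alpha> k l) \<and> clog_P b \<alpha> k l = measure gauss_measure (cell k l)"
        if "l \<in> {1..b - 1}" for k l
      proof -
        have "l \<in> {1..<b}" using that assms by auto
        from *(2)[OF this] show ?thesis by (auto simp: convergent_def clog_P_def limI)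
      qed
      with *(1) show "clog_infinite b \<alpha> \<and>
           (\<forall>k. \<forall>l\<in>{1..b - 1}.
              convergent (clog_freq b \<alpha> k l) \<and>
              clog_P b \<alpha> k l =
                ln (((1 + inverse (real l) * inverse (real b ^ k)) *
                     (real b + inverse (real l + 1) * inverse (real b ^ k))) /
                    ((real b + inverse (real l) * inverse (real b ^ k)) *
                     (1 + inverse (real l + 1) * inverse (real b ^ k))))
                / ln (2 * real b / (real b + 1)))"
        by (simp add: measure_gauss_cell)
    qed
  qed
qed

end
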